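(* For smooth functions $f$, $h$ of $(t,x,v)$, $$\hat ZQ_c(f,h)=Q_c(\hat Zf,h)+Q_c(f,\hat Zh),\qquad\hat Z=\partial_t,\ \partial_{x_i},\ \hat\Omega_{ij},\ S,$$ and $$\hat\Omega_iQ_c(f,h)=Q_c(\hat\Omega_if,h)+Q_c(f,\hat\Omega_ih)-\frac{v_i}{v_0}Q_c(f,h).$$ Therefore, the relativistic Boltzmann operator satisfies a commutator structure compatible with the vector field algebra.
   Context: $c\ge1$ is the speed of light; $v_0=\sqrt{c^2+|v|^2}$ (similarly $u_0,v_0',u_0'$). Indices $i,j$ range over $\{1,2,3\}$, with $i\ne j$ in $\hat\Omega_{ij}$. The vector fields are $S=\frac1c\big(t\partial_t+\sum_ix_i\partial_{x_i}\big)$, $\hat\Omega_i=t\partial_{x_i}+\frac1{c^2}x_i\partial_t+\frac{v_0}c\partial_{v_i}$, $\hat\Omega_{ij}=x_i\partial_{x_j}-x_j\partial_{x_i}+v_i\partial_{v_j}-v_j\partial_{v_i}$. The relativistic Boltzmann operator acts in $v$, with $(t,x)$ as parameters: $$Q_c(h,f)(v)=\int_{\mathbb{R}^3}\int_{\mathbb{S}^2}B_c(v,u)\big(h(u')f(v')-h(u)f(v)\big)\,d\omega\,du,$$ where $g=\sqrt{2(v_0u_0-v\cdot u-c^2)}$, $s=2(v_0u_0-v\cdot u+c^2)=g^2+4c^2$, $B_c(v,u)=v_\phi\,\sigma(g,\vartheta)$, $v_\phi=\frac{cg\sqrt s}{4v_0u_0}$, $\sigma(g,\vartheta)=|g|^{\gamma-1}\sigma_0(\vartheta)$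 with $0\le\sigma_0(\vartheta)\lesssim1$ (the paper works with $\gamma\in(-2,0]$), $$v'=\frac{v+u}2+\frac g2\left(\omega+(v+u)\frac{(v+u)\cdot\omega}{\sqrt s(v_0+u_0+\sqrt s)}\right),\quad u'=\frac{v+u}2-\frac g2\left(\omega+(v+u)\frac{(v+u)\cdot\omega}{\sqrt s(v_0+u_0+\sqrt s)}\right),$$ and $\cos\vartheta=\frac{-(v_0-u_0)(v_0'-u_0')+(v-u)\cdot(v'-u')}{g^2}$.
   Formalization: The boost correction is v_i/(c v_0) Q_c, since the printed v_i/v_0 fails for c>1; f, h are smooth and, with their ∂_t, ∂_{x_i} and Ω̂_i derivatives, are O(v_0^{-3}) locally uniformly in (t,x), so that the collision integrals converge; σ_0 is measurable. *)

theory Defs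
  imports "HOL-Analysis.Analysis"
begin

type_synonym phase = "real \<times> (real^3) \<times> (real^3)"

text \<open>
  Phase space points are triples \<open>(t, x, v)\<close>. The speed of light \<open>c\<close> is an explicit
  parameter throughout; \<open>energy c v\<close> is \<open>v\<^sub>0\<close>, and likewise \<open>energy c u\<close> is \<open>u\<^sub>0\<close>.
\<close>

definition energy :: "real \<Rightarrow> real^3 \<Rightarrow> real" where
  "energy c v = sqrt (c\<^sup>2 + (norm v)\<^sup>2)"

subsection \<open>Partial derivatives, smoothness and the vector fields\<close>

definition d_t :: "(phase \<Rightarrow> real) \<Rightarrow> phase \<Rightarrow> real" where
  "d_t f z = frechet_derivative f (at z) (1, 0, 0)"

definition d_x :: "3 \<Rightarrow> (phase \<Rightarrow> real) \<Rightarrow> phase \<Rightarrow> real" where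
  "d_x i f z = frechet_derivative f (at z) (0, axis i 1, 0)"

definition d_v :: "3 \<Rightarrow> (phase \<Rightarrow> real) \<Rightarrow> phase \<Rightarrow> real" where
  "d_v i f z = frechet_derivative f (at z) (0, 0, axis i 1)"

primrec C_k :: "nat \<Rightarrow> ('a::euclidean_space \<Rightarrow> real) \<Rightarrow> bool" where
  "C_k 0 f \<longleftrightarrow> continuous_on UNIV f"
| "C_k (Suc k) f \<longleftrightarrow>
     f differentiable_on UNIV \<and> (\<forall>w. C_k k (\<lambda>z. frechet_derivative f (at z) w))"

definition smooth :: "('a::euclidean_space \<Rightarrow> real) \<Rightarrow> bool" where
  "smooth f \<longleftrightarrow> (\<forall>k. C_k k f)"

definition S_field :: "real \<Rightarrow> (phase \<Rightarrow> real) \<Rightarrow> phase \<Rightarrow> real" where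
  "S_field c f = (\<lambda>(t, x, v).
     1 / c * (t * d_t f (t, x, v) + (\<Sum>i\<in>UNIV. x $ i * d_x i f (t, x, v))))"

definition Omega_boost :: "real \<Rightarrow> 3 \<Rightarrow> (phase \<Rightarrow> real) \<Rightarrow> phase \<Rightarrow> real" where
  "Omega_boost c i f = (\<lambda>(t, x, v).
     t * d_x i f (t, x, v) + 1 / c\<^sup>2 * x $ i * d_t f (t, x, v)
     + energy c v / c * d_v i f (t, x, v))"

definition Omega_rot :: "3 \<Rightarrow> 3 \<Rightarrow> (phase \<Rightarrow> real) \<Rightarrow> phase \<Rightarrow> real" where
  "Omega_rot i j f = (\<lambda>(t, x, v).
     x $ i * d_x j f (t, x, v) - x $ j * d_x i f (t, x, v)
     + v $ i * d_v j f (t, x, v) - v $ j * d_v i f (t, x, v))"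

subsection \<open>The relativistic Boltzmann operator\<close>

text \<open>
  Surface measure on the unit sphere, as a Borel measure on the ambient space concentrated on the
  sphere. For \<open>A\<close> on the sphere, the cone \<open>{r \<omega> | 0 < r < 1, \<omega> \<in> A}\<close> has volume
  \<open>|A| \<integral>\<^sub>0\<^sup>1 r\<^sup>2 dr = |A| / 3\<close>, so three times Lebesgue measure on the unit ball is pushed forward
  along \<open>sgn x = x / |x|\<close>; the total mass is \<open>4 \<pi>\<close>.
\<close>

definition sphere_measure :: "(real^3) measure" where
  "sphere_measure = distr (density lborel (\<lambda>x. 3 * indicator (ball 0 1) x)) borel sgn"

definition rel_g :: "real \<Rightarrow> real^3 \<Rightarrow> real^3 \<Rightarrow> real" where
  "rel_g c v u = sqrt (2 * (energy c v * energy c u - v \<bullet> u - c\<^sup>2))"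

definition rel_s :: "real \<Rightarrow> real^3 \<Rightarrow> real^3 \<Rightarrow> real" where
  "rel_s c v u = 2 * (energy c v * energy c u - v \<bullet> u + c\<^sup>2)"

definition post_shift :: "real \<Rightarrow> real^3 \<Rightarrow> real^3 \<Rightarrow> real^3 \<Rightarrow> real^3" where
  "post_shift c v u \<omega> = (rel_g c v u / 2) *\<^sub>R
     (\<omega> + (((v + u) \<bullet> \<omega>) / (sqrt (rel_s c v u) * (energy c v + energy c u + sqrt (rel_s c v u))))
            *\<^sub>R (v + u))"

definition post_v :: "real \<Rightarrow> real^3 \<Rightarrow> real^3 \<Rightarrow> real^3 \<Rightarrow> real^3" where
  "post_v c v u \<omega> = (1 / 2) *\<^sub>R (v + u) + post_shift c v u \<omega>"

definition post_u :: "real \<Rightarrow> real^3 \<Rightarrow> real^3 \<Rightarrow> real^3 \<Rightarrow> real^3" where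
  "post_u c v u \<omega> = (1 / 2) *\<^sub>R (v + u) - post_shift c v u \<omega>"

definition scatter_angle :: "real \<Rightarrow> real^3 \<Rightarrow> real^3 \<Rightarrow> real^3 \<Rightarrow> real" where
  "scatter_angle c v u \<omega> =
     (let v' = post_v c v u \<omega>; u' = post_u c v u \<omega> in
      arccos ((- (energy c v - energy c u) * (energy c v' - energy c u') + (v - u) \<bullet> (v' - u'))
              / (rel_g c v u)\<^sup>2))"

definition v_phi :: "real \<Rightarrow> real^3 \<Rightarrow> real^3 \<Rightarrow> real" where
  "v_phi c v u = c * rel_g c v u * sqrt (rel_s c v u) / (4 * energy c v * energy c u)"

definition cross_section :: "real \<Rightarrow> (real \<Rightarrow> real) \<Rightarrow> real \<Rightarrow> real \<Rightarrow> real" where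
  "cross_section \<gamma> \<sigma>0 g \<theta> = \<bar>g\<bar> powr (\<gamma> - 1) * \<sigma>0 \<theta>"

definition coll_kernel ::
    "real \<Rightarrow> real \<Rightarrow> (real \<Rightarrow> real) \<Rightarrow> real^3 \<Rightarrow> real^3 \<Rightarrow> real^3 \<Rightarrow> real" where
  "coll_kernel c \<gamma> \<sigma>0 v u \<omega> =
     v_phi c v u * cross_section \<gamma> \<sigma>0 (rel_g c v u) (scatter_angle c v u \<omega>)"

definition Q_vel ::
    "real \<Rightarrow> real \<Rightarrow> (real \<Rightarrow> real) \<Rightarrow> (real^3 \<Rightarrow> real) \<Rightarrow> (real^3 \<Rightarrow> real) \<Rightarrow> real^3 \<Rightarrow> real" where
  "Q_vel c \<gamma> \<sigma>0 h f v =
     (LINT u|lborel. LINT \<omega>|sphere_measure.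
        coll_kernel c \<gamma> \<sigma>0 v u \<omega> *
        (h (post_u c v u \<omega>) * f (post_v c v u \<omega>) - h u * f v))"

definition Q_op ::
    "real \<Rightarrow> real \<Rightarrow> (real \<Rightarrow> real) \<Rightarrow> (phase \<Rightarrow> real) \<Rightarrow> (phase \<Rightarrow> real) \<Rightarrow> phase \<Rightarrow> real" where
  "Q_op c \<gamma> \<sigma>0 h f =
     (\<lambda>(t, x, v). Q_vel c \<gamma> \<sigma>0 (\<lambda>w. h (t, x, w)) (\<lambda>w. f (t, x, w)) v)"

subsection \<open>Admissible functions\<close>

text \<open>
  The collision integral of an arbitrary smooth function need not converge. The functions
  considered are therefore smooth and decay, together with their first derivatives along the
  vector fields, like \<open>v\<^sub>0\<^sup>-\<^sup>3\<close> in \<open>v\<close>, locally uniformly in \<open>(t, x)\<close>. The fields \<open>d_t\<close>, \<open>d_x i\<close> and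
  \<open>Omega_boost c i\<close> span the tangent space at every point, and the decay of \<open>Omega_rot i j f\<close> and
  \<open>S_field c f\<close> is a consequence.
\<close>

definition v_decay :: "real \<Rightarrow> (phase \<Rightarrow> real) \<Rightarrow> bool" where
  "v_decay c f \<longleftrightarrow>
     (\<forall>K. compact K \<longrightarrow> (\<exists>C. \<forall>(t, x)\<in>K. \<forall>v. \<bar>f (t, x, v)\<bar> \<le> C / energy c v ^ 3))"

definition admissible :: "real \<Rightarrow> (phase \<Rightarrow> real) \<Rightarrow> bool" where
  "admissible c f \<longleftrightarrow>
     smooth f \<and> v_decay c f \<and> v_decay c (d_t f) \<and>
     (\<forall>i. v_decay c (d_x i f)) \<and> (\<forall>i. v_decay c (Omega_boost c i f))"

end

theory Submission
  imports Defs
begin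

text \<open>
  The collision operator is Lorentz covariant: for a Lorentz map acting on velocities by \<open>\<phi>\<close>,
  \<open>(\<phi> v)\<^sub>0 Q(h, f)(\<phi> v) = v\<^sub>0 Q(h \<circ> \<phi>, f \<circ> \<phi>)(v)\<close> (\<open>Q_covariant\<close>). Each of the vector fields generates
  a group acting on space-time by an affine map and on velocities by a Lorentz map. Differentiating
  the covariance identity along this group gives the Leibniz rule, and the factor \<open>v\<^sub>0\<close>, which only
  boosts change, gives the correction term.

  Covariance has three ingredients. The collision map, written in the centre-of-mass frame, commutes
  with Lorentz maps up to a rotation of the collision parameter (\<open>wigner_rotation\<close>). The measure
  \<open>du / u\<^sub>0\<close> is Lorentz invariant (\<open>boost_preserves_invariant_measure\<close>) and the surface measure of the
  sphere is rotation invariant. Apart from the factor \<open>1 / (v\<^sub>0 u\<^sub>0)\<close> the kernel depends only on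
  Minkowski products (\<open>kernel_covariant\<close>).

  The kernel may be singular at \<open>u = v\<close>, and it is never differentiated. Covariance is used to keep the
  velocity argument of \<open>Q\<close> fixed while the parameter of the group enters only the two functions
  (\<open>Q_has_derivative\<close>, \<open>Q_transport_has_derivative\<close>). The integrals converge because the kernel is
  bounded by an integrable singularity \<open>|v - u|\<^sup>\<gamma>\<close> and gains half a power of \<open>u\<^sub>0\<close> at infinity
  (\<open>kernel_dominated\<close>), while conservation of energy transfers the decay of the two functions at the
  post-collisional velocities to \<open>u\<close> (\<open>collision_bound\<close>).

  Labelling boosts by the image of the rest velocity turns this into one family over phase space
  (\<open>boost_family\<close>). Evaluated with output velocity \<open>0\<close> it shows that \<open>Q\<close> is totally differentiable in
  \<open>(t, x, v)\<close>, since every velocity is reached from rest (\<open>Q_phase_differentiable\<close>); differentiated at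
  the trivial boost it gives the identities for \<open>d_t\<close>, \<open>d_x i\<close>, \<open>S_field\<close> and \<open>Omega_boost\<close> at once
  (\<open>Q_phase_boost_identity\<close>). Rotations form a second family (\<open>Q_phase_rotation_identity\<close>).
\<close>

section \<open>Minkowski geometry and boosts\<close>

text \<open>
  Energy-momentum vectors are pairs (energy, velocity); the energy-momentum of a particle with
  velocity variable \<open>v\<close> is \<open>four c v\<close>. The Minkowski form carries no factor of \<open>c\<close>, because
  \<open>energy c v\<close> already has the dimension of \<open>v\<close>; the mass shell is \<open>mink X X = c\<^sup>2\<close>.
\<close>
definition mink :: "real \<times> (real^3) \<Rightarrow> real \<times> (real^3) \<Rightarrow> real" where
  "mink X Y = fst X * fst Y - snd X \<bullet> snd Y"

definition four :: "real \<Rightarrow> real^3 \<Rightarrow> real \<times> (real^3)" where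
  "four c v = (energy c v, v)"

text \<open>
  The rotation-free Lorentz map that takes a particle at rest, \<open>(c, 0)\<close>, to \<open>four c p\<close>. Labelling
  boosts by the velocity \<open>p\<close> of the image of rest makes them a smooth family over all of \<open>\<real>\<^sup>3\<close>.
\<close>
definition boost :: "real \<Rightarrow> real^3 \<Rightarrow> real \<times> (real^3) \<Rightarrow> real \<times> (real^3)" where
  "boost c p X = ((energy c p * fst X + p \<bullet> snd X) / c,
     snd X + (fst X / c + (p \<bullet> snd X) / (c * (c + energy c p))) *\<^sub>R p)"

lemma fst_four [simp]: "fst (four c v) = energy c v" and snd_four [simp]: "snd (four c v) = v"
  by (simp_all add: four_def)

lemma energy_sq: "(energy c v)\<^sup>2 = c\<^sup>2 + v \<bullet> v"
  by (simp add: energy_def power2_norm_eq_inner)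

lemma energy_ge_c: "c \<le> energy c v"
  unfolding energy_def by (rule real_le_rsqrt) simp

lemma energy_pos: "c > 0 \<Longrightarrow> 0 < energy c v"
  using energy_ge_c[of c v] by linarith

lemma norm_less_energy: "c > 0 \<Longrightarrow> norm v < energy c v"
  unfolding energy_def by (rule real_less_rsqrt) simp

lemma energy_0 [simp]: "c > 0 \<Longrightarrow> energy c 0 = c"
  by (simp add: energy_def)

lemma energy_eqI: "0 < a \<Longrightarrow> a\<^sup>2 = c\<^sup>2 + v \<bullet> v \<Longrightarrow> energy c v = a"
  by (simp add: energy_def power2_norm_eq_inner [symmetric] real_sqrt_unique)

lemma mink_add_left: "mink (X + Y) Z = mink X Z + mink Y Z"
  and mink_add_right: "mink Z (X + Y) = mink Z X + mink Z Y"
  and mink_diff_left: "mink (X - Y) Z = mink X Z - mink Y Z"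
  and mink_diff_right: "mink Z (X - Y) = mink Z X - mink Z Y"
  and mink_scale_left: "mink (a *\<^sub>R X) Z = a * mink X Z"
  and mink_scale_right: "mink Z (a *\<^sub>R X) = a * mink Z X"
  by (simp_all add: mink_def algebra_simps inner_simps)

lemmas mink_simps = mink_add_left mink_add_right mink_diff_left mink_diff_right
  mink_scale_left mink_scale_right

lemma mink_commute: "mink X Y = mink Y X"
  by (simp add: mink_def inner_commute)

lemma mink_four_self: "mink (four c v) (four c v) = c\<^sup>2"
  using energy_sq[of c v] by (simp add: mink_def power2_eq_square)

lemma four_eqI: "0 < fst X \<Longrightarrow> mink X X = c\<^sup>2 \<Longrightarrow> X = four c (snd X)"
  using energy_eqI[of "fst X" c "snd X"]
  by (simp add: mink_def four_def prod_eq_iff power2_eq_square)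

lemma linear_boost: "linear (boost c p)"
  by (rule linearI) (simp_all add: boost_def algebra_simps inner_simps add_divide_distrib)

text \<open>
  The coefficient of \<open>p\<close> in a boost, with the denominator cleared, so that the two algebraic
  identities below become polynomial.
\<close>
lemma boost_coefficient:
  assumes "c > 0" "E > (0::real)"
  shows "c * (a / c + r / (c * (c + E))) * (c + E) = a * (c + E) + r"
proof -
  have "c + E \<noteq> 0" using assms by simp
  then have "a / c + r / (c * (c + E)) = (a * (c + E) + r) / (c * (c + E))"
    by (simp add: add_divide_distrib)
  then show ?thesis using assms \<open>c + E \<noteq> 0\<close> by simp
qed

lemma mink_boost:
  assumes "c > 0"
  shows "mink (boost c p X) (boost c p Y) = mink X Y"
proof -
  define E where "E = energy c p"
  have E: "E > 0" "p \<bullet> p = E\<^sup>2 - c\<^sup>2" using energy_pos[OF assms] energy_sq[of c p] by (auto simp: E_def)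
  obtain a x b y where XY: "X = (a, x)" "Y = (b, y)" by (metis surj_pair)
  define r where "r = p \<bullet> x"
  define r' where "r' = p \<bullet> y"
  define k where "k = a / c + r / (c * (c + E))"
  define k' where "k' = b / c + r' / (c * (c + E))"
  have kk: "c * k * (c + E) = a * (c + E) + r" "c * k' * (c + E) = b * (c + E) + r'"
    unfolding k_def k'_def by (rule boost_coefficient[OF assms E(1)])+
  have "c\<^sup>2 * (c + E)\<^sup>2 * (k' * r + k * r' + k * k' * (E\<^sup>2 - c\<^sup>2)) =
      c * (c + E) * ((c * k' * (c + E)) * r + (c * k * (c + E)) * r')
      + (c * k * (c + E)) * (c * k' * (c + E)) * (E\<^sup>2 - c\<^sup>2)"
    by algebra
  also have "\<dots> = (c + E)\<^sup>2 * ((E * a + r) * (E * b + r')) - c\<^sup>2 * (c + E)\<^sup>2 * (a * b)"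
    unfolding kk by algebra
  finally have "(c + E)\<^sup>2 * (c\<^sup>2 * (k' * r + k * r' + k * k' * (E\<^sup>2 - c\<^sup>2))) =
      (c + E)\<^sup>2 * ((E * a + r) * (E * b + r') - c\<^sup>2 * (a * b))"
    by algebra
  then have "c\<^sup>2 * (k' * r + k * r' + k * k' * (E\<^sup>2 - c\<^sup>2)) = (E * a + r) * (E * b + r') - c\<^sup>2 * (a * b)"
    using assms E by (subst (asm) mult_cancel_left) auto
  then have "k' * r + k * r' + k * k' * (E\<^sup>2 - c\<^sup>2) = ((E * a + r) * (E * b + r')) / c\<^sup>2 - a * b"
    using assms by (simp add: field_simps)
  then show ?thesis
    by (simp add: XY boost_def mink_def inner_simps inner_commute[of x p] E(2)
        flip: E_def r_def r'_def k_def k'_def) (simp add: power2_eq_square algebra_simps)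
qed

lemma boost_inverse:
  assumes "c > 0"
  shows "boost c (- p) (boost c p X) = X"
proof -
  define E where "E = energy c p"
  have E: "E > 0" "p \<bullet> p = E\<^sup>2 - c\<^sup>2" using energy_pos[OF assms] energy_sq[of c p] by (auto simp: E_def)
  have Em: "energy c (- p) = E" by (simp add: E_def energy_def)
  obtain a x where X: "X = (a, x)" by (metis surj_pair)
  define r where "r = p \<bullet> x"
  define k where "k = a / c + r / (c * (c + E))"
  have kk: "c * k * (c + E) = a * (c + E) + r"
    unfolding k_def by (rule boost_coefficient[OF assms E(1)])
  have kN: "k * (E\<^sup>2 - c\<^sup>2) = (a * (E + c) + r) * (E - c) / c"
  proof -
    have "c * (k * (E\<^sup>2 - c\<^sup>2)) = (c * k * (c + E)) * (E - c)" by algebra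
    then show ?thesis unfolding kk using assms by (simp add: field_simps)
  qed
  have 1: "(E * ((E * a + r) / c) - (r + k * (E\<^sup>2 - c\<^sup>2))) / c = a"
    unfolding kN using assms E by (simp add: field_simps)
  have 2: "(E * a + r) / c / c - (r + k * (E\<^sup>2 - c\<^sup>2)) / (c * (c + E)) = k"
  proof -
    have "(E * a + r) / c / c - (r + k * (E\<^sup>2 - c\<^sup>2)) / (c * (c + E)) = a / c + r / (c * (c + E))"
    proof -
      have nz: "c \<noteq> 0" "c + E \<noteq> 0" using assms E by auto
      show ?thesis unfolding kN using nz by (simp add: divide_simps) algebra
    qed
    then show ?thesis by (simp add: k_def)
  qed
  have "fst (boost c (- p) (boost c p X)) = (E * ((E * a + r) / c) - (r + k * (E\<^sup>2 - c\<^sup>2))) / c"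
    by (simp add: X boost_def Em E(2) inner_simps flip: E_def r_def k_def) (simp add: algebra_simps)
  then have fst: "fst (boost c (- p) (boost c p X)) = a" unfolding 1 .
  define d where "d = c * (c + E)"
  have k_d: "a / c + r / d = k" by (simp add: k_def d_def)
  have "snd (boost c (- p) (boost c p X)) =
      x + k *\<^sub>R p - ((E * a + r) / c / c - (r + k * (E\<^sup>2 - c\<^sup>2)) / d) *\<^sub>R p"
    by (simp add: X boost_def Em E(2) inner_simps k_d flip: E_def r_def d_def)
       (simp add: algebra_simps add_divide_distrib diff_divide_distrib)
  then have "snd (boost c (- p) (boost c p X)) = x" unfolding d_def 2 by simp
  with fst show ?thesis by (simp add: X prod_eq_iff)
qed

lemma boost_rest: "c > 0 \<Longrightarrow> boost c p (c, 0) = four c p"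
  by (simp add: boost_def four_def)

text \<open>
  Positivity of energies excludes time reversal: it is what makes such a map send the upper mass shell
  to itself and hence act on velocities.
\<close>
definition lorentz :: "real \<Rightarrow> (real \<times> (real^3) \<Rightarrow> real \<times> (real^3)) \<Rightarrow> bool" where
  "lorentz c T \<longleftrightarrow> linear T \<and> (\<forall>X Y. mink (T X) (T Y) = mink X Y) \<and> (\<forall>v. 0 < fst (T (four c v)))"

definition vel_map :: "real \<Rightarrow> (real \<times> (real^3) \<Rightarrow> real \<times> (real^3)) \<Rightarrow> real^3 \<Rightarrow> real^3" where
  "vel_map c T v = snd (T (four c v))"

lemma lorentz_four: "lorentz c T \<Longrightarrow> T (four c v) = four c (vel_map c T v)"
  unfolding vel_map_def lorentz_def using mink_four_self[of c v] by (intro four_eqI) metis+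

text \<open>
  The reversed Cauchy-Schwarz inequality for two vectors of the upper mass shell. It is the source of
  \<open>g\<^sup>2 \<ge> 0\<close> and \<open>s \<ge> 4 c\<^sup>2\<close>.
\<close>
lemma mink_four_ge:
  assumes "c > 0"
  shows "c\<^sup>2 \<le> mink (four c v) (four c u)"
proof -
  have "v \<bullet> u \<le> norm v * norm u" by (rule norm_cauchy_schwarz)
  moreover have "c\<^sup>2 + norm v * norm u \<le> energy c v * energy c u"
  proof (rule power2_le_imp_le)
    have "2 * (norm v * norm u) \<le> (norm v)\<^sup>2 + (norm u)\<^sup>2"
      using sum_squares_bound[of "norm v" "norm u"] by (simp add: ac_simps)
    then have "c\<^sup>2 * (2 * (norm v * norm u)) \<le> c\<^sup>2 * ((norm v)\<^sup>2 + (norm u)\<^sup>2)"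
      by (rule mult_left_mono) simp
    then show "(c\<^sup>2 + norm v * norm u)\<^sup>2 \<le> (energy c v * energy c u)\<^sup>2"
      by (simp add: power_mult_distrib energy_sq flip: power2_norm_eq_inner)
         (simp add: power2_eq_square algebra_simps)
    show "0 \<le> energy c v * energy c u" using energy_pos[OF assms] by (simp add: less_imp_le)
  qed
  ultimately show ?thesis by (simp add: mink_def)
qed

lemma lorentz_boost:
  assumes "c > 0" shows "lorentz c (boost c p)"
proof -
  have "fst (boost c p (four c v)) = mink (four c (-p)) (four c v) / c" for v
    by (simp add: boost_def mink_def energy_def)
  moreover have "mink (four c (-p)) (four c v) > 0" for v
    using mink_four_ge[OF assms, of "-p" v] assms zero_less_power[OF assms, of 2] by linarith
  ultimately show ?thesis
    using assms by (simp add: lorentz_def linear_boost mink_boost)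
qed

section \<open>The post-collisional velocities in the centre-of-mass frame\<close>

lemma rel_s_mink: "rel_s c v u = 2 * (mink (four c v) (four c u) + c\<^sup>2)"
  and rel_g_mink: "rel_g c v u = sqrt (2 * (mink (four c v) (four c u) - c\<^sup>2))"
  by (simp_all add: rel_s_def rel_g_def mink_def)

lemma rel_s_pos: "c > 0 \<Longrightarrow> rel_s c v u > 0"
  unfolding rel_s_mink by (smt (verit) mink_four_ge zero_less_power)

lemma rel_g_nonneg: "0 \<le> rel_g c v u" if "c > 0"
  using mink_four_ge[OF that, of v u] by (simp add: rel_g_mink)

lemma rel_g_sq: "c > 0 \<Longrightarrow> (rel_g c v u)\<^sup>2 = 2 * (mink (four c v) (four c u) - c\<^sup>2)"
  using mink_four_ge[of c v u] by (simp add: rel_g_mink)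

text \<open>
  The velocity for which \<open>boost c (cm_vel c v u)\<close> leads from the centre-of-mass frame of the two
  particles back to the given frame.
\<close>
definition cm_vel :: "real \<Rightarrow> real^3 \<Rightarrow> real^3 \<Rightarrow> real^3" where
  "cm_vel c v u = (c / sqrt (rel_s c v u)) *\<^sub>R (v + u)"

text \<open>
  The total energy-momentum has Minkowski square \<open>s\<close>, so that rescaling it by \<open>c / sqrt s\<close> puts it on
  the mass shell.
\<close>
lemma four_cm_vel:
  assumes "c > 0"
  shows "four c (cm_vel c v u) = (c / sqrt (rel_s c v u)) *\<^sub>R (four c v + four c u)"
proof -
  let ?X = "(c / sqrt (rel_s c v u)) *\<^sub>R (four c v + four c u)"
  have s: "rel_s c v u > 0" by (rule rel_s_pos[OF assms])
  have "?X = four c (snd ?X)"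
  proof (rule four_eqI)
    show "0 < fst ?X" using s assms by (simp add: energy_pos add_pos_pos)
    have "mink ?X ?X = c\<^sup>2 / rel_s c v u * mink (four c v + four c u) (four c v + four c u)"
      using s by (simp add: mink_scale_left mink_scale_right power2_eq_square)
    also have "mink (four c v + four c u) (four c v + four c u) = rel_s c v u"
      by (simp add: mink_simps mink_four_self rel_s_mink mink_commute[of "four c u" "four c v"])
    finally show "mink ?X ?X = c\<^sup>2" using s by simp
  qed
  then show ?thesis by (simp add: cm_vel_def)
qed

lemma four_sum_boost:
  assumes "c > 0"
  shows "four c v + four c u = (sqrt (rel_s c v u) / c) *\<^sub>R boost c (cm_vel c v u) (c, 0)"
  using assms rel_s_pos[OF assms, of v u] by (simp add: boost_rest four_cm_vel)

text \<open>
  The bracket in the definition of the post-collisional velocities is the spatial part of the boosted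
  direction \<open>(0, \<omega>)\<close>.
\<close>
lemma post_shift_boost:
  assumes "c > 0"
  shows "post_shift c v u w = (rel_g c v u / 2) *\<^sub>R snd (boost c (cm_vel c v u) (0, w))"
proof -
  define S where "S = sqrt (rel_s c v u)"
  define P0 where "P0 = energy c v + energy c u"
  have S: "S > 0" using rel_s_pos[OF assms] by (simp add: S_def)
  have P0: "P0 > 0" using energy_pos[OF assms] by (simp add: P0_def add_pos_pos)
  have en: "energy c (cm_vel c v u) = c / S * P0"
    using arg_cong[OF four_cm_vel[OF assms, of v u], of fst] by (simp add: S_def P0_def)
  have *: "c / S * r / (c * (c + c / S * P0)) * (c / S) = r / (S * (P0 + S))" for r
  proof -
    have "c * (c + c / S * P0) = c\<^sup>2 * (P0 + S) / S"
      using assms S by (simp add: field_simps power2_eq_square)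
    then show ?thesis using assms S P0 by (simp add: power2_eq_square)
  qed
  have "snd (boost c (cm_vel c v u) (0, w)) =
      w + (c / S * ((v + u) \<bullet> w) / (c * (c + energy c (cm_vel c v u))) * (c / S)) *\<^sub>R (v + u)"
    by (simp add: boost_def cm_vel_def flip: S_def)
  then show ?thesis
    unfolding en * by (simp add: post_shift_def flip: S_def P0_def)
qed

text \<open>
  In the centre-of-mass frame the two outgoing particles have opposite velocities of modulus \<open>g / 2\<close>
  along \<open>\<omega>\<close>, and each carries half of the total energy-momentum. Since \<open>s - g\<^sup>2 = 4 c\<^sup>2\<close>, both
  vectors lie on the mass shell, so their energies need not be computed from their velocities.
  Conservation of energy and the Lorentz covariance of the collision map are read off from this form.
\<close>
lemma four_post:
  assumes "c > 0" "norm w = 1"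
  shows "four c (post_v c v u w) = (1/2) *\<^sub>R (four c v + four c u) + (rel_g c v u / 2) *\<^sub>R boost c (cm_vel c v u) (0, w)" (is "_ = ?X")
    and "four c (post_u c v u w) = (1/2) *\<^sub>R (four c v + four c u) - (rel_g c v u / 2) *\<^sub>R boost c (cm_vel c v u) (0, w)" (is "_ = ?Y")
proof -
  define S where "S = sqrt (rel_s c v u)"
  define q where "q = cm_vel c v u"
  define g where "g = rel_g c v u"
  have S: "S > 0" using rel_s_pos[OF assms(1)] by (simp add: S_def)
  have SS: "S\<^sup>2 = rel_s c v u" using rel_s_pos[OF assms(1), of v u] by (simp add: S_def)
  have g: "g \<ge> 0" "g\<^sup>2 = S\<^sup>2 - 4 * c\<^sup>2"
    using rel_g_nonneg[OF assms(1)] rel_g_sq[OF assms(1), of v u] SS by (auto simp: g_def rel_s_mink)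
  have gS: "g < S" using S g assms(1) by (intro power2_less_imp_less[of g S]) auto
  have P: "four c v + four c u = boost c q (S, 0)"
    using assms(1) linear_cmul[OF linear_boost, of c q "S/c" "(c,0)"]
    by (simp add: four_sum_boost q_def S_def)
  have *: "four c (snd Z) = Z \<and> snd Z = (1/2) *\<^sub>R (v + u) + \<sigma> *\<^sub>R post_shift c v u w"
    if "Z = (1/2) *\<^sub>R (four c v + four c u) + (\<sigma> * (g / 2)) *\<^sub>R boost c q (0, w)" "\<bar>\<sigma>\<bar> = 1" for Z \<sigma>
  proof
    have Z: "Z = boost c q (S / 2, (\<sigma> * g / 2) *\<^sub>R w)"
      unfolding that P
      by (simp add: linear_cmul[OF linear_boost, symmetric] linear_add[OF linear_boost, symmetric])
    have \<sigma>: "\<sigma>\<^sup>2 = 1" using that(2) by (metis one_power2 power2_abs)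
    have ww: "w \<bullet> w = 1" using assms(2) by (simp flip: power2_norm_eq_inner)
    have "mink Z Z = (S/2)\<^sup>2 - (\<sigma> * g / 2)\<^sup>2 * (w \<bullet> w)"
      unfolding Z mink_boost[OF assms(1)] by (simp add: mink_def power2_eq_square)
    also have "\<dots> = c\<^sup>2" using g \<sigma> ww by (simp add: power_mult_distrib power_divide field_simps)
    finally have m: "mink Z Z = c\<^sup>2" .
    have "\<bar>q \<bullet> ((\<sigma> * g / 2) *\<^sub>R w)\<bar> \<le> norm q * (g / 2)"
      using Cauchy_Schwarz_ineq2[of q "(\<sigma> * g / 2) *\<^sub>R w"] that(2) g(1) assms(2)
      by (simp add: abs_mult)
    also have "\<dots> \<le> energy c q * (g / 2)"
      using norm_less_energy[OF assms(1), of q] g(1) by (intro mult_right_mono) auto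
    also have "\<dots> < energy c q * (S / 2)"
      using gS energy_pos[OF assms(1), of q] by simp
    finally have "0 < fst Z" unfolding Z using assms(1) by (simp add: boost_def abs_less_iff)
    from four_eqI[OF this m] show "four c (snd Z) = Z" ..
    show "snd Z = (1/2) *\<^sub>R (v + u) + \<sigma> *\<^sub>R post_shift c v u w"
      unfolding that(1) post_shift_boost[OF assms(1)] by (simp add: g_def q_def)
  qed
  have "post_v c v u w = snd ?X" "?X = four c (snd ?X)"
    using *[of ?X 1] by (simp_all only: g_def q_def post_v_def) auto
  then show "four c (post_v c v u w) = ?X" by simp
  have "post_u c v u w = snd ?Y" "?Y = four c (snd ?Y)"
    using *[of ?Y "-1"] by (simp_all only: g_def q_def post_u_def) auto
  then show "four c (post_u c v u w) = ?Y" by simp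
qed

lemma energy_post:
  assumes "c > 0" "norm w = 1"
  shows "energy c (post_v c v u w) + energy c (post_u c v u w) = energy c v + energy c u"
  using arg_cong[OF four_post(1)[OF assms, of v u], of fst] arg_cong[OF four_post(2)[OF assms, of v u], of fst]
  by simp

definition cos_angle :: "real \<Rightarrow> real^3 \<Rightarrow> real^3 \<Rightarrow> real^3 \<Rightarrow> real" where
  "cos_angle c v u w = (let v' = post_v c v u w; u' = post_u c v u w in
     (- (energy c v - energy c u) * (energy c v' - energy c u') + (v - u) \<bullet> (v' - u')) / (rel_g c v u)\<^sup>2)"

lemma scatter_angle_cos: "scatter_angle c v u w = arccos (cos_angle c v u w)"
  by (simp add: scatter_angle_def cos_angle_def Let_def)

lemma cos_angle_mink:
  "cos_angle c v u w = - mink (four c v - four c u) (four c (post_v c v u w) - four c (post_u c v u w)) / (rel_g c v u)\<^sup>2"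
  by (simp add: cos_angle_def Let_def mink_def algebra_simps)

text \<open>
  The difference \<open>four c v - four c u\<close> is orthogonal to the total energy-momentum and hence purely
  spatial in the centre-of-mass frame, of length \<open>g\<close>; there the quotient defining the scattering angle
  is the inner product of two unit vectors. For \<open>g = 0\<close> it is a division by zero with value \<open>0\<close>.
\<close>
lemma abs_cos_angle_le_1:
  assumes "c > 0" "norm w = 1"
  shows "\<bar>cos_angle c v u w\<bar> \<le> 1"
proof -
  define q where "q = cm_vel c v u"
  define g where "g = rel_g c v u"
  define D where "D = boost c (- q) (four c v - four c u)"
  \<comment> \<open>D is the relative energy-momentum in the centre-of-mass frame\<close>
  have D: "four c v - four c u = boost c q D"
    using boost_inverse[OF assms(1), of "- q"] by (simp add: D_def)
  have "mink (four c v + four c u) (four c v - four c u) = 0"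
    by (simp add: mink_simps mink_four_self mink_commute[of "four c u" "four c v"])
  then have "mink (boost c q (c, 0)) (boost c q D) = 0"
    using assms(1) rel_s_pos[OF assms(1), of v u] unfolding D four_sum_boost[OF assms(1)]
    by (simp add: mink_simps q_def)
  then have "mink (c, 0) D = 0" unfolding mink_boost[OF assms(1)] .
  then have fD: "fst D = 0" using assms(1) by (simp add: mink_def)
  have "mink (four c v - four c u) (four c v - four c u) = - (g\<^sup>2)"
    unfolding g_def rel_g_sq[OF assms(1)]
    by (simp add: mink_simps mink_four_self mink_commute[of "four c u" "four c v"])
  then have "mink D D = - (g\<^sup>2)" unfolding D using assms(1) by (simp add: mink_boost)
  then have "(norm (snd D))\<^sup>2 = g\<^sup>2" using fD by (simp add: mink_def power2_norm_eq_inner)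
  then have nD: "norm (snd D) = g" using rel_g_nonneg[OF assms(1)] by (simp add: g_def)
  have "four c (post_v c v u w) - four c (post_u c v u w) = g *\<^sub>R boost c q (0, w)"
    by (simp add: four_post[OF assms] g_def q_def flip: scaleR_add_left)
  then have "cos_angle c v u w = g * (snd D \<bullet> w) / g\<^sup>2"
    unfolding cos_angle_mink D g_def[symmetric]
    using assms(1) fD by (simp add: mink_simps mink_boost) (simp add: mink_def)
  moreover have "\<bar>snd D \<bullet> w\<bar> \<le> g" using Cauchy_Schwarz_ineq2[of "snd D" w] nD assms(2) by simp
  moreover have "0 \<le> g" using nD norm_ge_zero by metis
  ultimately show ?thesis
    by (cases "g = 0") (auto simp: power2_eq_square abs_mult)
qed

text \<open>
  Transporting a collision by \<open>T\<close> changes the centre-of-mass frame, and the two boosts out of the old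
  and the new frame differ from \<open>T\<close> by a map fixing the rest vector. Such a map is a rotation of the
  collision parameter \<open>\<omega>\<close>; it depends on \<open>v\<close> and \<open>u\<close>, but the integral over the sphere does not see it.
\<close>
lemma wigner_rotation:
  assumes "c > 0" "lorentz c T"
  obtains R where "orthogonal_transformation R"
    "\<And>w. norm w = 1 \<Longrightarrow> post_v c (vel_map c T v) (vel_map c T u) (R w) = vel_map c T (post_v c v u w)"
    "\<And>w. norm w = 1 \<Longrightarrow> post_u c (vel_map c T v) (vel_map c T u) (R w) = vel_map c T (post_u c v u w)"
proof -
  have T: "linear T" "\<And>X Y. mink (T X) (T Y) = mink X Y" using assms(2) by (auto simp: lorentz_def)
  have T4: "four c (vel_map c T x) = T (four c x)" for x
    using lorentz_four[OF assms(2)] by simp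
  define q where "q = cm_vel c v u"
  define q' where "q' = cm_vel c (vel_map c T v) (vel_map c T u)"
  have s: "rel_s c (vel_map c T v) (vel_map c T u) = rel_s c v u"
    and g: "rel_g c (vel_map c T v) (vel_map c T u) = rel_g c v u"
    by (simp_all add: rel_s_mink rel_g_mink T4 T(2))
  have q': "four c q' = T (four c q)"
    unfolding q_def q'_def four_cm_vel[OF assms(1)] s T4
    by (simp add: linear_cmul[OF T(1)] linear_add[OF T(1)])
  \<comment> \<open>the Wigner rotation: out of the old centre-of-mass frame, along T, into the new one\<close>
  define W where "W = (\<lambda>X. boost c (- q') (T (boost c q X)))"
  have linW: "linear W"
    unfolding W_def using linear_compose[OF linear_compose[OF linear_boost T(1)] linear_boost, of c "- q'" c q]
    by (simp add: o_def)
  have minkW: "mink (W X) (W Y) = mink X Y" for X Y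
    by (simp add: W_def mink_boost[OF assms(1)] T(2))
  have TW: "T (boost c q X) = boost c q' (W X)" for X
    using boost_inverse[OF assms(1), of "- q'"] by (simp add: W_def)
  have rest: "W (c, 0) = (c, 0)"
  proof -
    have "W (c, 0) = boost c (- q') (boost c q' (c, 0))"
      by (simp add: W_def boost_rest[OF assms(1)] q')
    then show ?thesis by (simp add: boost_inverse[OF assms(1)])
  qed
  define R where "R = (\<lambda>w. snd (W (0, w)))"
  have W0: "W (0, w) = (0, R w)" for w
  proof -
    have "mink (W (c, 0)) (W (0, w)) = 0" unfolding minkW by (simp add: mink_def)
    then have "fst (W (0, w)) = 0" using assms(1) unfolding rest by (simp add: mink_def)
    then show ?thesis by (simp add: R_def prod_eq_iff)
  qed
  have "linear R"
  proof (rule linearI)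
    show "R (x + y) = R x + R y" for x y using linear_add[OF linW, of "(0,x)" "(0,y)"] by (simp add: R_def)
    show "R (r *\<^sub>R x) = r *\<^sub>R R x" for r x using linear_cmul[OF linW, of r "(0,x)"] by (simp add: R_def)
  qed
  moreover have "R x \<bullet> R y = x \<bullet> y" for x y
    using minkW[of "(0,x)" "(0,y)"] unfolding W0 by (simp add: mink_def)
  ultimately have R: "orthogonal_transformation R" by (simp add: orthogonal_transformation_def)
  show thesis
  proof
    fix w :: "real^3" assume w: "norm w = 1"
    then have w': "norm (R w) = 1" using R by (simp add: orthogonal_transformation_norm)
    have B: "boost c q' (0, R w) = T (boost c q (0, w))" by (simp add: TW W0)
    have "four c (post_v c (vel_map c T v) (vel_map c T u) (R w)) = T (four c (post_v c v u w))"
      unfolding four_post[OF assms(1) w'] four_post[OF assms(1) w] g T4 q'_def[symmetric] q_def[symmetric] B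
      by (simp add: linear_cmul[OF T(1)] linear_add[OF T(1)])
    then show "post_v c (vel_map c T v) (vel_map c T u) (R w) = vel_map c T (post_v c v u w)"
      by (metis snd_four vel_map_def)
    have "four c (post_u c (vel_map c T v) (vel_map c T u) (R w)) = T (four c (post_u c v u w))"
      unfolding four_post[OF assms(1) w'] four_post[OF assms(1) w] g T4 q'_def[symmetric] q_def[symmetric] B
      by (simp add: linear_cmul[OF T(1)] linear_add[OF T(1)] linear_diff[OF T(1)])
    then show "post_u c (vel_map c T v) (vel_map c T u) (R w) = vel_map c T (post_u c v u w)"
      by (metis snd_four vel_map_def)
  qed (rule R)
qed

lemma rel_vel_map:
  assumes "lorentz c T"
  shows "rel_s c (vel_map c T v) (vel_map c T u) = rel_s c v u"
    and "rel_g c (vel_map c T v) (vel_map c T u) = rel_g c v u"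
  using assms unfolding rel_s_mink rel_g_mink lorentz_four[OF assms, symmetric] by (metis lorentz_def)+


section \<open>Invariant measures\<close>

text \<open>
  The change of variables theorem as an identity of measures, which applies to the Bochner integral of
  any measurable integrand. It suffices to compare both sides on boxes.
\<close>
lemma lborel_eq_distr_density_jacobian:
  fixes \<phi> :: "real^'n::{finite,wellorder} \<Rightarrow> real^'n::_"
  assumes der: "\<And>x. (\<phi> has_derivative \<phi>' x) (at x)" and bij: "bij \<phi>"
    and det: "\<And>x. \<bar>det (matrix (\<phi>' x))\<bar> = J x" and J: "J \<in> borel_measurable borel"
  shows "lborel = distr (density lborel (\<lambda>x. ennreal (J x))) borel \<phi>"
proof (rule lborel_eqI)
  have meas: "\<phi> \<in> borel \<rightarrow>\<^sub>M borel"
    using der by (intro borel_measurable_continuous_onI) (meson continuous_at_imp_continuous_on has_derivative_continuous)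
  fix l u :: "real^'n::{finite,wellorder}"
  assume lu: "\<And>b. b \<in> Basis \<Longrightarrow> l \<bullet> b \<le> u \<bullet> b"
  let ?S = "\<phi> -` box l u"
  have Sb: "?S \<in> sets borel" using measurable_sets[OF meas, of "box l u"] by simp
  have img: "\<phi> ` ?S = box l u" using bij by (simp add: bij_is_surj surj_image_vimage_eq)
  have "\<phi> ` ?S \<in> lmeasurable \<and> measure lebesgue (\<phi> ` ?S) = measure lborel (box l u)"
    unfolding img by simp
  then have "((\<lambda>x. \<bar>det (matrix (\<phi>' x))\<bar>) has_integral measure lborel (box l u)) ?S"
    by (rule iffD1[OF has_measure_differentiable_image[where f = \<phi>], rotated 3])
       (use Sb has_derivative_at_withinI[OF der] bij in \<open>auto simp: bij_def intro: inj_on_subset\<close>)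
  then have "integral\<^sup>N lborel (\<lambda>x. ennreal (J x) * indicator ?S x) = ennreal (measure lborel (box l u))"
    unfolding det by (intro nn_integral_has_integral_lebesgue') (simp_all flip: det)
  then have "emeasure (distr (density lborel (\<lambda>x. ennreal (J x))) borel \<phi>) (box l u) = ennreal (measure lborel (box l u))"
    using meas J Sb by (simp add: emeasure_distr emeasure_density)
  also have "\<dots> = emeasure lborel (box l u)" 
    using emeasure_lborel_box_finite[of l u] by (subst emeasure_eq_ennreal_measure) auto
  also have "\<dots> = (\<Prod>b\<in>Basis. (u - l) \<bullet> b)" using lu by simp
  finally show "emeasure (distr (density lborel (\<lambda>x. ennreal (J x))) borel \<phi>) (box l u) = (\<Prod>b\<in>Basis. (u - l) \<bullet> b)" .
qed simp

lemma energy_continuous [continuous_intros]: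
  "continuous_on S f \<Longrightarrow> continuous_on S (\<lambda>x. energy c (f x))"
  unfolding energy_def by (intro continuous_intros)

lemma energy_measurable [measurable]: "energy c \<in> borel_measurable borel"
  by (intro borel_measurable_continuous_onI continuous_intros)

lemma energy_has_derivative:
  assumes "c > 0"
  shows "(energy c has_derivative (\<lambda>h. v \<bullet> h / energy c v)) (at v)"
proof -
  have *: "energy c = (\<lambda>v. sqrt (c\<^sup>2 + v \<bullet> v))" by (simp add: energy_def power2_norm_eq_inner fun_eq_iff)
  have "c\<^sup>2 + v \<bullet> v > 0" using assms by (intro add_pos_nonneg) auto
  then show ?thesis unfolding *
    by (auto intro!: derivative_eq_intros simp: field_simps inner_commute)
qed

lemma vel_map_boost:
  "vel_map c (boost c p) w = w + (energy c w / c + (p \<bullet> w) / (c * (c + energy c p))) *\<^sub>R p"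
  by (simp add: vel_map_def boost_def)

lemma energy_vel_map_boost:
  "c > 0 \<Longrightarrow> energy c (vel_map c (boost c p) w) = (energy c p * energy c w + p \<bullet> w) / c"
  using lorentz_four[OF lorentz_boost, of c p w] by (metis boost_def fst_conv fst_four snd_four)

lemma det_rank_one_update: "det (matrix (\<lambda>h::real^3. h + (q \<bullet> h) *\<^sub>R p)) = 1 + p \<bullet> q"
  by (simp add: det_3 matrix_def inner_vec_def sum_3 axis_def) (simp add: algebra_simps)

lemma bij_vel_map:
  assumes "lorentz c T" "lorentz c T'" "\<And>X. T' (T X) = X" "\<And>X. T (T' X) = X"
  shows "bij (vel_map c T)"
proof (rule bij_betw_byWitness[where f' = "vel_map c T'"])
  have "vel_map c T' (vel_map c T x) = x" "vel_map c T (vel_map c T' x) = x" for x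
    using lorentz_four[OF assms(1)] lorentz_four[OF assms(2)] assms(3,4) by (metis snd_four vel_map_def)+
  then show "\<forall>a\<in>UNIV. vel_map c T' (vel_map c T a) = a" "\<forall>a'\<in>UNIV. vel_map c T (vel_map c T' a') = a'" by auto
qed auto

text \<open>
  Invariance of the measure \<open>du / u\<^sub>0\<close> on the mass shell, written as a statement about Lebesgue measure.
\<close>
definition preserves_invariant_measure :: "real \<Rightarrow> (real^3 \<Rightarrow> real^3) \<Rightarrow> bool" where
  "preserves_invariant_measure c \<phi> \<longleftrightarrow> \<phi> \<in> borel \<rightarrow>\<^sub>M borel \<and>
     lborel = distr (density lborel (\<lambda>u. ennreal (energy c (\<phi> u) / energy c u))) borel \<phi>"

text \<open>
  The derivative of a boost acting on velocities is a rank-one perturbation of the identity in the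
  direction \<open>p\<close>, so its determinant is explicit and turns out to be the quotient of the energies.
\<close>
lemma boost_preserves_invariant_measure:
  assumes c: "c > 0"
  shows "preserves_invariant_measure c (vel_map c (boost c p))" (is "preserves_invariant_measure c ?\<phi>")
  unfolding preserves_invariant_measure_def
proof
  define \<phi>' where "\<phi>' = (\<lambda>w h. h + (((1 / (c * energy c w)) *\<^sub>R w + (1 / (c * (c + energy c p))) *\<^sub>R p) \<bullet> h) *\<^sub>R p)"
  have der: "(?\<phi> has_derivative \<phi>' w) (at w)" for w
  proof -
    have "?\<phi> = (\<lambda>w. w + ((1 / c) * energy c w + (1 / (c * (c + energy c p))) * (p \<bullet> w)) *\<^sub>R p)"
      by (simp add: vel_map_boost fun_eq_iff)
    moreover have "c \<noteq> 0" "c + energy c p \<noteq> 0" using c energy_pos[OF c, of p] by auto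
    ultimately show ?thesis
      unfolding \<phi>'_def by (auto intro!: derivative_eq_intros energy_has_derivative[OF c] simp: inner_simps)
  qed
  show meas: "?\<phi> \<in> borel \<rightarrow>\<^sub>M borel"
    using der by (intro borel_measurable_continuous_onI) (meson continuous_at_imp_continuous_on has_derivative_continuous)
  show "lborel = distr (density lborel (\<lambda>u. ennreal (energy c (?\<phi> u) / energy c u))) borel ?\<phi>"
  proof (rule lborel_eq_distr_density_jacobian[OF der])
    show "bij ?\<phi>"
      using boost_inverse[OF c, of p] boost_inverse[OF c, of "-p"]
      by (intro bij_vel_map[where T' = "boost c (- p)"] lorentz_boost c) auto
    fix w
    have E: "energy c p > 0" "energy c w > 0" by (simp_all add: energy_pos c)
    have "p \<bullet> p = (c + energy c p) * (energy c p - c)"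
      using energy_sq[of c p] by (simp add: power2_eq_square algebra_simps)
    moreover have "c + energy c p \<noteq> 0" using E c by simp
    ultimately have pp: "p \<bullet> p / (c * (c + energy c p)) = (energy c p - c) / c" by simp
    have "det (matrix (\<phi>' w)) = 1 + p \<bullet> w / (c * energy c w) + p \<bullet> p / (c * (c + energy c p))"
      unfolding \<phi>'_def det_rank_one_update by (simp add: inner_simps)
    also have "\<dots> = energy c (?\<phi> w) / energy c w"
      unfolding pp energy_vel_map_boost[OF c] using E c by (simp add: field_simps)
    finally show "\<bar>det (matrix (\<phi>' w))\<bar> = energy c (?\<phi> w) / energy c w"
      using energy_pos[OF c, of "?\<phi> w"] E by simp
  qed (use meas in measurable)
qed

definition spatial :: "(real^3 \<Rightarrow> real^3) \<Rightarrow> real \<times> (real^3) \<Rightarrow> real \<times> (real^3)" where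
  "spatial R X = (fst X, R (snd X))"

lemma vel_map_spatial [simp]: "vel_map c (spatial R) = R"
  by (simp add: vel_map_def spatial_def fun_eq_iff)

lemma lorentz_spatial:
  assumes "orthogonal_transformation R" "c > 0"
  shows "lorentz c (spatial R)"
proof -
  have R: "linear R" "\<And>x y. R x \<bullet> R y = x \<bullet> y" using assms by (auto simp: orthogonal_transformation_def)
  have "linear (spatial R)"
    by (rule linearI) (simp_all add: spatial_def linear_add[OF R(1)] linear_cmul[OF R(1)])
  then show ?thesis using R assms(2) by (simp add: lorentz_def spatial_def mink_def energy_pos)
qed

lemma energy_orthogonal: "orthogonal_transformation R \<Longrightarrow> energy c (R u) = energy c u"
  by (simp add: energy_def orthogonal_transformation_norm)

lemma orthogonal_measurable: "orthogonal_transformation R \<Longrightarrow> R \<in> borel \<rightarrow>\<^sub>M borel" for R :: "real^3 \<Rightarrow> real^3"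
  by (intro borel_measurable_continuous_onI linear_continuous_on)
     (simp add: linear_linear orthogonal_transformation_linear)

lemma lborel_orthogonal:
  fixes R :: "real^3 \<Rightarrow> real^3"
  assumes "orthogonal_transformation R"
  shows "distr lborel borel R = lborel"
proof -
  have "lborel = distr (density lborel (\<lambda>x. ennreal 1)) borel R"
  proof (rule lborel_eq_distr_density_jacobian)
    show "(R has_derivative R) (at x)" for x
      by (intro bounded_linear_imp_has_derivative) (simp add: linear_linear assms orthogonal_transformation_linear)
    show "bij R" by (rule orthogonal_transformation_bij[OF assms])
    have "orthogonal_matrix (matrix R)" using assms by (simp add: orthogonal_transformation_matrix)
    from det_orthogonal_matrix[OF this] show "\<bar>det (matrix R)\<bar> = 1" by auto
  qed simp
  then show ?thesis by (simp add: density_1)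
qed

lemma orthogonal_preserves_invariant_measure:
  assumes "orthogonal_transformation R" "c > 0"
  shows "preserves_invariant_measure c R"
proof -
  have "energy c u \<noteq> 0" for u using energy_pos[OF assms(2), of u] by simp
  then show ?thesis
    using lborel_orthogonal[OF assms(1)] orthogonal_measurable[OF assms(1)]
    by (simp add: preserves_invariant_measure_def energy_orthogonal[OF assms(1)] density_1)
qed

section \<open>The surface measure of the sphere\<close>

lemma sets_sphere_measure [simp, measurable_cong]: "sets sphere_measure = sets borel"
  and space_sphere_measure [simp]: "space sphere_measure = UNIV"
  by (simp_all add: sphere_measure_def)

lemma sgn_measurable: "(sgn :: real^3 \<Rightarrow> real^3) \<in> borel \<rightarrow>\<^sub>M borel"
  unfolding sgn_div_norm[abs_def] by measurable

lemma cone_density_measurable [measurable]: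
  "(\<lambda>x::real^3. 3 * indicator (ball 0 1) x :: ennreal) \<in> borel_measurable borel"
  by (intro borel_measurable_times_ennreal borel_measurable_indicator borel_measurable_const) simp

lemma finite_sphere_measure: "finite_measure sphere_measure"
proof
  have "emeasure sphere_measure (space sphere_measure) =
      (\<integral>\<^sup>+x. 3 * indicator (ball (0::real^3) 1) x \<partial>lborel)"
    unfolding sphere_measure_def using sgn_measurable by (simp add: emeasure_distr emeasure_density)
  also have "\<dots> = 3 * emeasure lborel (ball 0 1 :: (real^3) set)"
    by (subst nn_integral_cmult_indicator) simp_all
  also have "\<dots> < \<infinity>" using emeasure_lborel_ball_finite[of "0::real^3" 1] by (simp add: ennreal_mult_less_top)
  finally show "emeasure sphere_measure (space sphere_measure) \<noteq> \<infinity>" by simp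
qed

interpretation sphere: finite_measure sphere_measure by (rule finite_sphere_measure)

interpretation lborel_sphere: pair_sigma_finite "lborel :: (real^3) measure" sphere_measure ..

lemma AE_sphere_norm: "AE w in sphere_measure. norm w = 1"
proof -
  have "AE x in lborel. (x::real^3) \<noteq> 0" by (rule AE_lborel_singleton)
  then have "AE x in density lborel (\<lambda>x. 3 * indicator (ball 0 1) x). norm (sgn x :: real^3) = 1"
    by (subst AE_density) (auto simp: norm_sgn)
  then show ?thesis
    unfolding sphere_measure_def using sgn_measurable by (subst AE_distr_iff) auto
qed

lemma sphere_measure_rotation:
  assumes "orthogonal_transformation R"
  shows "distr sphere_measure borel R = sphere_measure"
proof -
  note [measurable] = orthogonal_measurable[OF assms] sgn_measurable
  let ?d = "\<lambda>x::real^3. 3 * indicator (ball 0 1) x :: ennreal"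
  have lin: "linear R" by (rule orthogonal_transformation_linear[OF assms])
  have sgnR: "R (sgn x) = sgn (R x)" for x
    by (simp add: sgn_div_norm linear_cmul[OF lin] orthogonal_transformation_norm[OF assms])
  have "distr sphere_measure borel R = distr (density lborel ?d) borel (R \<circ> sgn)"
    unfolding sphere_measure_def by (subst distr_distr) auto
  also have "\<dots> = distr (density lborel ?d) borel (sgn \<circ> R)" by (simp add: o_def sgnR)
  also have "\<dots> = distr (distr (density lborel ?d) borel R) borel sgn" by (subst distr_distr) auto
  also have "distr (density lborel ?d) borel R = distr (density lborel (\<lambda>x. ?d (R x))) borel R"
    by (simp add: indicator_def orthogonal_transformation_norm[OF assms])
  also have "\<dots> = density (distr lborel borel R) ?d"
    by (rule density_distr[symmetric]) simp_all
  also have "\<dots> = density lborel ?d" unfolding lborel_orthogonal[OF assms] ..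
  finally show ?thesis by (simp add: sphere_measure_def)
qed

lemma sphere_integral_rotation:
  fixes k :: "real^3 \<Rightarrow> real"
  assumes "orthogonal_transformation R" "k \<in> borel_measurable borel"
  shows "(LINT w|sphere_measure. k (R w)) = (LINT w|sphere_measure. k w)"
proof -
  have "(LINT w|sphere_measure. k w) = (LINT w|distr sphere_measure borel R. k w)"
    by (simp add: sphere_measure_rotation[OF assms(1)])
  also have "\<dots> = (LINT w|sphere_measure. k (R w))"
    by (intro integral_distr assms(2)) (use orthogonal_measurable[OF assms(1)] in simp)
  finally show ?thesis by simp
qed


section \<open>Differentiation under the integral sign\<close>

text \<open>
  A bound on difference quotients passes to the derivative.
\<close>
lemma has_derivative_lipschitz_bound:
  fixes F :: "'p::real_normed_vector \<Rightarrow> real"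
  assumes e: "e > 0" and lip: "\<And>p. p \<in> ball p0 e \<Longrightarrow> \<bar>F p - F p0\<bar> \<le> L * norm (p - p0)"
    and der: "(F has_derivative F') (at p0)"
  shows "\<bar>F' h\<bar> \<le> L * norm h"
proof (cases "h = 0")
  case True
  then show ?thesis using linear_0[OF has_derivative_linear[OF der]] by simp
next
  case False
  have g: "((\<lambda>t. p0 + t *\<^sub>R h) has_derivative (\<lambda>t. t *\<^sub>R h)) (at 0)"
    by (auto intro!: derivative_eq_intros)
  have "((\<lambda>t. F (p0 + t *\<^sub>R h)) has_derivative (\<lambda>t. F' (t *\<^sub>R h))) (at 0)"
    using has_derivative_compose[OF g, of F F'] der by simp
  then have "((\<lambda>t. F (p0 + t *\<^sub>R h)) has_field_derivative F' h) (at 0)"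
    unfolding has_field_derivative_def
    by (simp add: linear_cmul[OF has_derivative_linear[OF der]] mult.commute[of _ "F' h"] ext)
  then have "((\<lambda>t. (F (p0 + t *\<^sub>R h) - F p0) / t) \<longlongrightarrow> F' h) (at 0)"
    by (simp add: DERIV_def)
  then have "((\<lambda>t. \<bar>(F (p0 + t *\<^sub>R h) - F p0) / t\<bar>) \<longlongrightarrow> \<bar>F' h\<bar>) (at 0)"
    by (rule tendsto_rabs)
  moreover have "\<forall>\<^sub>F t in at 0. \<bar>(F (p0 + t *\<^sub>R h) - F p0) / t\<bar> \<le> L * norm h"
    unfolding eventually_at
  proof (intro exI[of _ "e / norm h"] conjI ballI impI)
    show "0 < e / norm h" using e False by simp
    fix t :: real assume t: "t \<noteq> 0 \<and> dist t 0 < e / norm h"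
    then have "p0 + t *\<^sub>R h \<in> ball p0 e" using False by (simp add: dist_norm field_simps)
    from lip[OF this] have "\<bar>F (p0 + t *\<^sub>R h) - F p0\<bar> \<le> L * (\<bar>t\<bar> * norm h)" by simp
    then show "\<bar>(F (p0 + t *\<^sub>R h) - F p0) / t\<bar> \<le> L * norm h" using t by (simp add: field_simps)
  qed
  ultimately show ?thesis by (rule tendsto_upperbound) simp
qed

text \<open>
  A derivative is a sequential limit of difference quotients and inherits their measurability.
\<close>
lemma borel_measurable_derivative:
  fixes k :: "'p::real_normed_vector \<Rightarrow> 'a \<Rightarrow> real"
  assumes e: "e > 0" and meas: "\<And>p. p \<in> ball p0 e \<Longrightarrow> k p \<in> borel_measurable M"
    and der: "\<And>y. y \<in> space M \<Longrightarrow> ((\<lambda>p. k p y) has_derivative k' y) (at p0)"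
  shows "(\<lambda>y. k' y h) \<in> borel_measurable M"
proof (cases "h = 0")
  case True
  have "k' y h = 0" if "y \<in> space M" for y
    using linear_0[OF has_derivative_linear[OF der[OF that]]] True by simp
  then show ?thesis by (simp cong: measurable_cong)
next
  case False
  define t where "t n = e / (2 * norm h) / real (Suc n)" for n
  have t0: "t n > 0" for n using e False by (simp add: t_def)
  have tlim: "t \<longlonglongrightarrow> 0" unfolding t_def[abs_def] using LIMSEQ_Suc[OF lim_const_over_n] by blast
  have tb: "p0 + t n *\<^sub>R h \<in> ball p0 e" for n
  proof -
    have "t n * norm h = e / 2 / real (Suc n)" using False by (simp add: t_def)
    also have "\<dots> < e" using e by (simp add: field_simps) (use e in \<open>smt (verit) mult_nonneg_nonneg of_nat_0_le_iff\<close>)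
    finally show ?thesis using t0[of n] by (simp add: dist_norm)
  qed
  have m0: "k p0 \<in> borel_measurable M" using meas[of p0] e by simp
  show ?thesis
  proof (rule borel_measurable_LIMSEQ_real)
    show "(\<lambda>y. (k (p0 + t n *\<^sub>R h) y - k p0 y) / t n) \<in> borel_measurable M" for n
      using meas[OF tb] m0 by measurable
    fix y assume y: "y \<in> space M"
    have g: "((\<lambda>t. p0 + t *\<^sub>R h) has_derivative (\<lambda>t. t *\<^sub>R h)) (at 0)"
      by (auto intro!: derivative_eq_intros)
    have "((\<lambda>t. k (p0 + t *\<^sub>R h) y) has_derivative (\<lambda>t. k' y (t *\<^sub>R h))) (at 0)"
      using has_derivative_compose[OF g, of "\<lambda>p. k p y" "k' y"] der[OF y] by simp
    then have "((\<lambda>t. k (p0 + t *\<^sub>R h) y) has_field_derivative k' y h) (at 0)"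
      unfolding has_field_derivative_def
      by (simp add: linear_cmul[OF has_derivative_linear[OF der[OF y]]] mult.commute[of _ "k' y h"] ext)
    then have "((\<lambda>t. (k (p0 + t *\<^sub>R h) y - k p0 y) / t) \<longlongrightarrow> k' y h) (at 0)"
      by (simp add: DERIV_def)
    moreover have "filterlim t (at 0) sequentially"
      using tlim t0 by (simp add: filterlim_at less_imp_neq[symmetric] eventually_sequentiallyI)
    ultimately show "(\<lambda>n. (k (p0 + t n *\<^sub>R h) y - k p0 y) / t n) \<longlonglongrightarrow> k' y h"
      by (rule filterlim_compose)
  qed
qed

text \<open>
  Dominated convergence applied to the remainder quotients, which are bounded by twice the Lipschitz
  constant \<open>D y\<close>. The parameter may be multidimensional, and the derivative is the total one.
\<close>
lemma has_derivative_lebesgue_integral: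
  fixes k :: "'p::real_normed_vector \<Rightarrow> 'a \<Rightarrow> real"
  assumes e: "e > 0" and int: "\<And>p. p \<in> ball p0 e \<Longrightarrow> integrable M (k p)"
    and D: "integrable M D"
    and lip: "AE y in M. \<forall>p\<in>ball p0 e. \<bar>k p y - k p0 y\<bar> \<le> D y * norm (p - p0)"
    and der: "\<And>y. y \<in> space M \<Longrightarrow> ((\<lambda>p. k p y) has_derivative k' y) (at p0)"
  shows "((\<lambda>p. LINT y|M. k p y) has_derivative (\<lambda>h. LINT y|M. k' y h)) (at p0)"
    and "integrable M (\<lambda>y. k' y h)"
proof -
  have meas: "(\<lambda>y. k' y h) \<in> borel_measurable M" for h
    by (rule borel_measurable_derivative[OF e _ der]) (rule borel_measurable_integrable, rule int)
  have bound: "AE y in M. \<forall>h. \<bar>k' y h\<bar> \<le> D y * norm h"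
    using lip AE_space
  proof eventually_elim
    case (elim y)
    then show ?case using has_derivative_lipschitz_bound[OF e _ der, of y "D y"] by blast
  qed
  have int': "integrable M (\<lambda>y. k' y h)" for h
  proof (rule Bochner_Integration.integrable_bound)
    show "integrable M (\<lambda>y. D y * norm h)" using D by simp
    show "AE y in M. norm (k' y h) \<le> norm (D y * norm h)"
      using bound by eventually_elim (auto intro: order_trans)
  qed (rule meas)
  show "integrable M (\<lambda>y. k' y h)" by (rule int')
  let ?F = "\<lambda>p. LINT y|M. k p y" and ?F' = "\<lambda>h. LINT y|M. k' y h"
  have lin: "linear (k' y)" if "y \<in> space M" for y
    using der[OF that] by (rule has_derivative_linear)
  have "bounded_linear ?F'"
  proof (rule bounded_linear_intro[where K = "LINT y|M. D y"])
    show "?F' (a + b) = ?F' a + ?F' b" for a b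
      by (subst Bochner_Integration.integral_add[symmetric, OF int' int'])
         (auto intro!: Bochner_Integration.integral_cong simp: linear_add[OF lin])
    show "?F' (r *\<^sub>R a) = r *\<^sub>R ?F' a" for r a
    proof -
      have "?F' (r *\<^sub>R a) = (LINT y|M. r * k' y a)"
        by (rule Bochner_Integration.integral_cong) (simp_all add: linear_cmul[OF lin])
      then show ?thesis by simp
    qed
    show "norm (?F' a) \<le> norm a * (LINT y|M. D y)" for a
    proof -
      have "norm (?F' a) \<le> (LINT y|M. D y * norm a)"
      proof (rule order_trans[OF integral_norm_bound integral_mono_AE])
        show "AE y in M. norm (k' y a) \<le> D y * norm a" using bound by eventually_elim auto
      qed (use int' D in auto)
      then show ?thesis by (simp add: mult.commute)
    qed
  qed
  moreover have "((\<lambda>h. norm (?F (p0 + h) - ?F p0 - ?F' h) / norm h) \<longlongrightarrow> 0) (at 0)"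
    unfolding tendsto_at_iff_sequentially
  proof (intro allI impI)
    fix X :: "nat \<Rightarrow> 'p" assume X: "\<forall>i. X i \<in> UNIV - {0}" "X \<longlonglongrightarrow> 0"
    from LIMSEQ_D[OF X(2) e] obtain N where N: "\<And>n. n \<ge> N \<Longrightarrow> norm (X n) < e" by auto
    define r where "r n y = \<bar>k (p0 + X (n + N)) y - k p0 y - k' y (X (n + N))\<bar> / norm (X (n + N))" for n y
    have inb: "p0 + X (n + N) \<in> ball p0 e" for n using N[of "n + N"] by (simp add: dist_norm)
    have r_int: "integrable M (r n)" for n
      unfolding r_def[abs_def] using int[OF inb] int[of p0] e int' by auto
    have "(\<lambda>n. LINT y|M. r n y) \<longlonglongrightarrow> (LINT y|M. 0)"
    proof (rule integral_dominated_convergence[where w = "\<lambda>y. 2 * D y"])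
      show "AE y in M. (\<lambda>n. r n y) \<longlonglongrightarrow> 0"
        using AE_space
      proof eventually_elim
        case (elim y)
        have "((\<lambda>h. norm (k (p0 + h) y - k p0 y - k' y h) / norm h) \<longlongrightarrow> 0) (at 0)"
          using der[OF elim] by (simp add: has_derivative_at)
        moreover have "filterlim (\<lambda>n. X (n + N)) (at 0) sequentially"
          using X LIMSEQ_ignore_initial_segment[OF X(2), of N] by (simp add: filterlim_at)
        ultimately show ?case unfolding r_def real_norm_def by (rule filterlim_compose)
      qed
      show "AE y in M. norm (r n y) \<le> 2 * D y" for n
        using lip bound
      proof eventually_elim
        case (elim y)
        have x0: "norm (X (n + N)) > 0" using X by auto
        have "\<bar>k (p0 + X (n + N)) y - k p0 y - k' y (X (n + N))\<bar> \<le> 2 * D y * norm (X (n + N))"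
          using bspec[OF elim(1) inb[of n]] spec[OF elim(2), of "X (n + N)"] by simp
        then show ?case using x0 by (simp add: r_def field_simps)
      qed
    qed (use D r_int in auto)
    then have lim0: "(\<lambda>n. LINT y|M. r n y) \<longlonglongrightarrow> 0" by simp
    have bnd: "norm (norm (?F (p0 + X (n + N)) - ?F p0 - ?F' (X (n + N))) / norm (X (n + N))) \<le> (LINT y|M. r n y)" for n
    proof -
      have "?F (p0 + X (n + N)) - ?F p0 - ?F' (X (n + N)) =
          (LINT y|M. k (p0 + X (n + N)) y - k p0 y - k' y (X (n + N)))"
        using int[OF inb] int[of p0] e int' by simp
      also have "norm \<dots> \<le> (LINT y|M. \<bar>k (p0 + X (n + N)) y - k p0 y - k' y (X (n + N))\<bar>)"
        using integral_norm_bound[of M "\<lambda>y. k (p0 + X (n + N)) y - k p0 y - k' y (X (n + N))"] by simp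
      finally show ?thesis by (simp add: r_def divide_right_mono)
    qed
    have "(\<lambda>n. norm (?F (p0 + X (n + N)) - ?F p0 - ?F' (X (n + N))) / norm (X (n + N))) \<longlonglongrightarrow> 0"
      by (rule Lim_null_comparison[OF always_eventually[OF allI[OF bnd]] lim0])
    then show "((\<lambda>h. norm (?F (p0 + h) - ?F p0 - ?F' h) / norm h) \<circ> X) \<longlonglongrightarrow> 0"
      unfolding o_def by (rule LIMSEQ_offset)
  qed
  ultimately show "(?F has_derivative ?F') (at p0)" by (simp add: has_derivative_at)
qed

section \<open>Integrability of radial powers\<close>

text \<open>
  A function bounded by \<open>m k\<close> on the part of the \<open>k\<close>-th ball where it is needed is dominated by the
  sum of the multiples \<open>m k\<close> of the indicators of the balls.
\<close>
lemma integrable_dyadic: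
  fixes f :: "'a::euclidean_space \<Rightarrow> real"
  assumes [measurable]: "f \<in> borel_measurable borel" and nn: "\<And>x. 0 \<le> f x"
    and m: "\<And>k. 0 \<le> m k" and r: "\<And>k. 0 \<le> r k"
    and sum: "summable (\<lambda>k. m k * r k ^ DIM('a))"
    and cover: "\<And>x. x \<noteq> z \<Longrightarrow> f x \<noteq> 0 \<Longrightarrow> \<exists>k::nat. dist z x < r k \<and> f x \<le> m k"
  shows "integrable lborel f"
proof (rule integrableI_nonneg)
  let ?V = "measure lborel (ball (0::'a) 1)"
  have "(\<integral>\<^sup>+ x. ennreal (f x) \<partial>lborel) \<le> (\<integral>\<^sup>+ x. (\<Sum>k. ennreal (m k) * indicator (ball z (r k)) x) \<partial>lborel)"
  proof (rule nn_integral_mono_AE)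
    have le_suminf: "g k \<le> suminf g" for g :: "nat \<Rightarrow> ennreal" and k
      using sum_le_suminf[of g "{k}"] by simp
    have "AE x in lborel. x \<noteq> z" by (rule AE_lborel_singleton)
    then show "AE x in lborel. ennreal (f x) \<le> (\<Sum>k. ennreal (m k) * indicator (ball z (r k)) x)"
    proof eventually_elim
      case (elim x)
      show ?case
      proof (cases "f x = 0")
        case False
        then obtain k where k: "dist z x < r k" "f x \<le> m k" using cover elim by blast
        then have "ennreal (f x) \<le> ennreal (m k) * indicator (ball z (r k)) x"
          by (simp add: ennreal_leI)
        also have "\<dots> \<le> (\<Sum>k. ennreal (m k) * indicator (ball z (r k)) x)"
          by (rule le_suminf)
        finally show ?thesis .
      qed simp
    qed
  qed
  also have "\<dots> = (\<Sum>k. \<integral>\<^sup>+ x. ennreal (m k) * indicator (ball z (r k)) x \<partial>lborel)"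
    by (intro nn_integral_suminf borel_measurable_times_ennreal borel_measurable_indicator) auto
  also have "\<dots> = (\<Sum>k. ennreal (m k * r k ^ DIM('a) * ?V))"
  proof (rule suminf_cong)
    fix k
    have "(\<integral>\<^sup>+ x. ennreal (m k) * indicator (ball z (r k)) x \<partial>lborel) = ennreal (m k) * emeasure lborel (ball z (r k))"
      by (rule nn_integral_cmult_indicator) simp
    also have "emeasure lborel (ball z (r k)) = ennreal (measure lborel (ball z (r k)))"
      using emeasure_lborel_ball_finite[of z "r k"] by (subst emeasure_eq_ennreal_measure) auto
    also have "measure lborel (ball z (r k)) = r k ^ DIM('a) * ?V"
      using content_ball_conv_unit_ball[OF r, of z] .
    finally show "(\<integral>\<^sup>+ x. ennreal (m k) * indicator (ball z (r k)) x \<partial>lborel) = ennreal (m k * r k ^ DIM('a) * ?V)"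
      using m r by (simp add: ennreal_mult' mult.assoc)
  qed
  also have "\<dots> < \<infinity>"
    using summable_mult2[OF sum, of ?V] m r by (subst suminf_ennreal2) (auto simp: less_top)
  finally show "(\<integral>\<^sup>+ x. ennreal (f x) \<partial>lborel) < \<infinity>" .
qed (use nn in auto)

lemma dyadic_interval:
  fixes x :: real assumes "1 \<le> x" shows "\<exists>k::nat. 2 ^ k \<le> x \<and> x < 2 ^ Suc k"
proof -
  define n where "n = (LEAST n. x < 2 ^ n)"
  have "\<exists>n. x < 2 ^ n" by (rule real_arch_pow) simp
  then have n: "x < 2 ^ n" unfolding n_def by (rule LeastI_ex)
  then have "n \<noteq> 0" using assms by (intro notI) auto
  then obtain k where k: "n = Suc k" by (meson not0_implies_Suc)
  have "\<not> x < 2 ^ k" using not_less_Least[of k "\<lambda>n. x < 2 ^ n"] k by (simp flip: n_def)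
  then show ?thesis using n k by (auto simp: not_less)
qed

lemma integrable_singular_power:
  fixes z :: "'a::euclidean_space" and a :: real
  assumes "0 \<le> a" "a < DIM('a)"
  shows "integrable lborel (\<lambda>x. indicator (ball z 1) x * dist z x powr (- a))"
proof (rule integrable_dyadic[where z = z and m = "\<lambda>k. 2 powr (real (Suc k) * a)" and r = "\<lambda>k. 2 * (1/2)^k"])
  show "(\<lambda>x. indicat_real (ball z 1) x * dist z x powr - a) \<in> borel_measurable borel"
    by (intro borel_measurable_times powr_real_measurable borel_measurable_dist borel_measurable_indicator) auto
  show "summable (\<lambda>k. 2 powr (real (Suc k) * a) * (2 * (1 / 2) ^ k) ^ DIM('a))"
  proof -
    have eq: "2 powr (real (Suc k) * a) * (2 * (1 / 2) ^ k) ^ DIM('a) =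
       2 powr a * 2 ^ DIM('a) * (2 powr (a - DIM('a))) ^ k" for k
    proof -
      have "((1/2::real) ^ k) ^ DIM('a) = 2 powr (- (real k * DIM('a)))"
        by (simp add: powr_minus powr_realpow power_mult flip: of_nat_mult) (simp add: power_divide field_simps)
      moreover have "(2 powr (a - DIM('a))) ^ k = 2 powr (real k * a) * 2 powr (- (real k * DIM('a)))"
        by (simp add: powr_realpow[symmetric] powr_powr algebra_simps flip: powr_add)
      moreover have "2 powr (real (Suc k) * a) = 2 powr a * 2 powr (real k * a)"
        by (simp add: algebra_simps flip: powr_add)
      ultimately show ?thesis by (simp add: power_mult_distrib)
    qed
    have "2 powr (a - DIM('a)) < 1" using assms powr_less_mono[of "a - DIM('a)" 0 2] by simp
    then show ?thesis unfolding eq by (intro summable_mult summable_geometric) simp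
  qed
  fix x assume x: "x \<noteq> z" "indicator (ball z 1) x * dist z x powr (- a) \<noteq> 0"
  then have d: "0 < dist z x" "dist z x < 1" by (auto simp: indicator_def split: if_splits)
  then obtain k :: nat where k: "2 ^ k \<le> 1 / dist z x" "1 / dist z x < 2 ^ Suc k"
    using dyadic_interval[of "1 / dist z x"] by auto
  have "dist z x \<le> (1/2)^k" using k(1) d by (simp add: field_simps power_divide)
  also have "\<dots> < 2 * (1/2)^k" by simp
  finally have 1: "dist z x < 2 * (1/2)^k" .
  have "dist z x powr (- a) = (1 / dist z x) powr a" using d by (simp add: powr_divide powr_minus_divide)
  also have "\<dots> \<le> (2 ^ Suc k) powr a" using k d assms by (intro powr_mono2) auto
  also have "\<dots> = 2 powr (real (Suc k) * a)" by (subst powr_realpow[symmetric]) (auto simp: powr_powr)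
  finally show "\<exists>k. dist z x < 2 * (1 / 2) ^ k \<and> indicator (ball z 1) x * dist z x powr (- a) \<le> 2 powr (real (Suc k) * a)"
    using 1 d by (auto intro!: exI[of _ k])
qed auto

lemma integrable_decaying_power:
  fixes z :: "'a::euclidean_space" and b :: real
  assumes "DIM('a) < b"
  shows "integrable lborel (\<lambda>x. indicator (- ball z 1) x * dist z x powr (- b))"
proof (rule integrable_dyadic[where z = z and m = "\<lambda>k. 2 powr (- (real k * b))" and r = "\<lambda>k. 2 ^ Suc k"])
  show "(\<lambda>x. indicat_real (- ball z 1) x * dist z x powr - b) \<in> borel_measurable borel"
    by (intro borel_measurable_times powr_real_measurable borel_measurable_dist borel_measurable_indicator) auto
  show "summable (\<lambda>k. 2 powr (- (real k * b)) * (2 ^ Suc k) ^ DIM('a))"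
  proof -
    have eq: "2 powr (- (real k * b)) * (2 ^ Suc k) ^ DIM('a) =
       2 ^ DIM('a) * (2 powr (DIM('a) - b)) ^ k" for k
    proof -
      have "((2::real) ^ k) ^ DIM('a) = 2 powr (real k * DIM('a))"
        by (simp add: powr_realpow power_mult flip: of_nat_mult)
      moreover have "(2 powr (DIM('a) - b)) ^ k = 2 powr (- (real k * b)) * 2 powr (real k * DIM('a))"
        by (simp add: powr_realpow[symmetric] powr_powr algebra_simps flip: powr_add)
      ultimately show ?thesis by (simp add: power_mult_distrib)
    qed
    have "2 powr (DIM('a) - b) < 1" using assms powr_less_mono[of "DIM('a) - b" 0 2] by simp
    then show ?thesis unfolding eq by (intro summable_mult summable_geometric) simp
  qed
  fix x assume x: "x \<noteq> z" "indicator (- ball z 1) x * dist z x powr (- b) \<noteq> 0"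
  then have d: "1 \<le> dist z x" by (auto simp: indicator_def split: if_splits)
  then obtain k :: nat where k: "2 ^ k \<le> dist z x" "dist z x < 2 ^ Suc k"
    using dyadic_interval by blast
  have "dist z x powr (- b) \<le> (2 ^ k) powr (- b)" using k d assms by (intro powr_mono2') auto
  also have "\<dots> = 2 powr (- (real k * b))" by (subst powr_realpow[symmetric]) (auto simp: powr_powr)
  finally show "\<exists>k. dist z x < 2 ^ Suc k \<and> indicator (- ball z 1) x * dist z x powr (- b) \<le> 2 powr (- (real k * b))"
    using k(2) d by (auto intro!: exI[of _ k] simp: indicator_def)
qed auto


section \<open>Size and measurability of the collision kernel\<close>

lemma energy_comp_measurable [measurable (raw)]:
  "f \<in> borel_measurable M \<Longrightarrow> (\<lambda>x. energy c (f x)) \<in> borel_measurable M"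
  by (rule measurable_compose[OF _ energy_measurable])

lemma rel_measurable [measurable (raw)]:
  assumes [measurable]: "f \<in> borel_measurable M" "g \<in> borel_measurable M"
  shows "(\<lambda>x. rel_g c (f x) (g x)) \<in> borel_measurable M" "(\<lambda>x. rel_s c (f x) (g x)) \<in> borel_measurable M"
  unfolding rel_g_def rel_s_def by measurable

lemma post_measurable [measurable (raw)]:
  assumes [measurable]: "f \<in> borel_measurable M" "g \<in> borel_measurable M" "w \<in> borel_measurable M"
  shows "(\<lambda>x. post_v c (f x) (g x) (w x)) \<in> borel_measurable M"
    and "(\<lambda>x. post_u c (f x) (g x) (w x)) \<in> borel_measurable M"
    and "(\<lambda>x. cos_angle c (f x) (g x) (w x)) \<in> borel_measurable M"
proof -
  show [measurable]: "(\<lambda>x. post_v c (f x) (g x) (w x)) \<in> borel_measurable M"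
    and [measurable]: "(\<lambda>x. post_u c (f x) (g x) (w x)) \<in> borel_measurable M"
    unfolding post_v_def post_u_def post_shift_def by measurable
  show "(\<lambda>x. cos_angle c (f x) (g x) (w x)) \<in> borel_measurable M"
    unfolding cos_angle_def Let_def by measurable
qed

text \<open>
  Outside \<open>[-1, 1]\<close> the value of \<open>arccos\<close> is unspecified, but it is the same value everywhere there:
  the defining description is the same empty one. Measurability therefore only depends on \<open>\<sigma>\<close> on \<open>[0, \<pi>]\<close>.
\<close>
lemma measurable_comp_arccos:
  assumes "set_borel_measurable borel {0..pi} \<sigma>"
  shows "(\<lambda>y. \<sigma> (arccos y) :: real) \<in> borel_measurable borel"
proof -
  define A where "A = (\<lambda>y::real. indicator {-1..1} y *\<^sub>R arccos y)"
  have A: "A \<in> borel_measurable borel"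
    unfolding A_def by (rule borel_measurable_continuous_on_indicator) (auto intro: continuous_on_arccos')
  have "(\<lambda>x. indicator {0..pi} x *\<^sub>R \<sigma> x) \<in> borel_measurable borel"
    using assms by (simp add: set_borel_measurable_def)
  from measurable_compose[OF A this]
  have "(\<lambda>y. if y \<in> {-1..1} then indicator {0..pi} (A y) *\<^sub>R \<sigma> (A y) else \<sigma> (THE x. False)) \<in> borel_measurable borel"
    by (intro measurable_If) auto
  moreover have "(\<lambda>y. \<sigma> (arccos y)) = (\<lambda>y. if y \<in> {-1..1} then indicator {0..pi} (A y) *\<^sub>R \<sigma> (A y) else \<sigma> (THE x. False))"
  proof
    fix y :: real
    show "\<sigma> (arccos y) = (if y \<in> {-1..1} then indicator {0..pi} (A y) *\<^sub>R \<sigma> (A y) else \<sigma> (THE x. False))"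
    proof (cases "y \<in> {-1..1}")
      case True
      then show ?thesis using arccos_lbound[of y] arccos_ubound[of y] by (simp add: A_def)
    next
      case False
      then have "(\<lambda>x. 0 \<le> x \<and> x \<le> pi \<and> cos x = y) = (\<lambda>x. False)" by (auto simp: fun_eq_iff)
      then have "arccos y = (THE x. False)" unfolding arccos_def by (simp only:)
      then show ?thesis using False by (simp only: if_False)
    qed
  qed
  ultimately show ?thesis by simp
qed

lemma rel_s_le:
  assumes "c > 0" shows "rel_s c v u \<le> 4 * (energy c v * energy c u)"
  using mink_four_ge[OF assms, of "- v" u] by (simp add: rel_s_def mink_def energy_def mult.commute)

text \<open>
  Expanding, \<open>g\<^sup>2 = |v - u|\<^sup>2 - (v\<^sub>0 - u\<^sub>0)\<^sup>2\<close>, while \<open>(v\<^sub>0 - u\<^sub>0) (v\<^sub>0 + u\<^sub>0) = (v - u) \<bullet> (v + u)\<close> is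
  controlled by Cauchy-Schwarz; the gain comes from \<open>(v\<^sub>0 + u\<^sub>0)\<^sup>2 - |v + u|\<^sup>2 = s \<ge> 4 c\<^sup>2\<close>.
\<close>
lemma rel_g_lower:
  assumes "c > 0"
  shows "2 * c * norm (v - u) / (energy c v + energy c u) \<le> rel_g c v u"
proof -
  define A where "A = energy c v"
  define B where "B = energy c u"
  have AB: "A > 0" "B > 0" "A\<^sup>2 = c\<^sup>2 + v \<bullet> v" "B\<^sup>2 = c\<^sup>2 + u \<bullet> u"
    by (simp_all add: A_def B_def energy_pos[OF assms] energy_sq)
  have g: "(rel_g c v u)\<^sup>2 = 2 * (A * B - v \<bullet> u - c\<^sup>2)"
    by (simp add: rel_g_sq[OF assms] mink_def A_def B_def)
  have z: "c\<^sup>2 + v \<bullet> u \<le> A * B"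
    using mink_four_ge[OF assms, of v u] by (simp add: mink_def A_def B_def)
  define N where "N = (v - u) \<bullet> (v - u)"
  have NN: "(norm (v - u))\<^sup>2 = N" by (simp only: N_def power2_norm_eq_inner)
  have N: "N = v \<bullet> v + u \<bullet> u - 2 * (v \<bullet> u)" "N \<ge> 0"
    by (simp add: N_def inner_diff_left inner_diff_right inner_commute) (simp add: N_def)
  have "(v \<bullet> v - u \<bullet> u)\<^sup>2 = ((v - u) \<bullet> (v + u))\<^sup>2"
    by (simp add: inner_simps inner_commute)
  also have "\<dots> \<le> N * ((v + u) \<bullet> (v + u))" unfolding N_def by (rule Cauchy_Schwarz_ineq)
  also have "\<dots> \<le> N * ((A + B)\<^sup>2 - 4 * c\<^sup>2)"
    using z N(2) AB by (intro mult_left_mono) (simp_all add: inner_simps inner_commute power2_sum)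
  finally have *: "(v \<bullet> v - u \<bullet> u)\<^sup>2 + 4 * c\<^sup>2 * N \<le> N * (A + B)\<^sup>2" by (simp add: algebra_simps)
  have "v \<bullet> v - u \<bullet> u = (A - B) * (A + B)" using AB by (simp add: power2_eq_square algebra_simps)
  then have "(v \<bullet> v - u \<bullet> u)\<^sup>2 = (A - B)\<^sup>2 * (A + B)\<^sup>2" by (simp add: power_mult_distrib)
  with * have "4 * c\<^sup>2 * N \<le> (N - (A - B)\<^sup>2) * (A + B)\<^sup>2"
    by (simp add: left_diff_distrib)
  also have "N - (A - B)\<^sup>2 = (rel_g c v u)\<^sup>2"
    unfolding g N(1) using AB by (simp add: power2_diff)
  finally have "4 * c\<^sup>2 * N \<le> (rel_g c v u * (A + B))\<^sup>2" by (simp only: power_mult_distrib)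
  moreover have "(2 * c * norm (v - u))\<^sup>2 = 4 * c\<^sup>2 * N" by (simp only: power_mult_distrib NN) simp
  ultimately have "(2 * c * norm (v - u))\<^sup>2 \<le> (rel_g c v u * (A + B))\<^sup>2" by (simp only:)
  then have "2 * c * norm (v - u) \<le> rel_g c v u * (A + B)"
    by (rule power2_le_imp_le) (simp add: AB less_imp_le rel_g_nonneg[OF assms])
  then show ?thesis using AB by (simp add: A_def B_def pos_divide_le_eq)
qed

text \<open>
  The hypotheses on the cross section, with the bound of the angular part as a parameter.
\<close>
locale collision_kernel =
  fixes c \<gamma> :: real and \<sigma>0 :: "real \<Rightarrow> real" and C0 :: real
  assumes c1: "1 \<le> c" and \<gamma>_gt: "-2 < \<gamma>" and \<gamma>_le: "\<gamma> \<le> 0"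
    and \<sigma>0_meas: "set_borel_measurable borel {0..pi} \<sigma>0"
    and \<sigma>0_bounds: "\<And>\<theta>. \<theta> \<in> {0..pi} \<Longrightarrow> 0 \<le> \<sigma>0 \<theta> \<and> \<sigma>0 \<theta> \<le> C0"
begin

abbreviation B where "B \<equiv> coll_kernel c \<gamma> \<sigma>0"
abbreviation Q where "Q \<equiv> Q_vel c \<gamma> \<sigma>0"

lemma c0: "c > 0" using c1 by simp

lemma energy_ge_1: "1 \<le> energy c v" using energy_ge_c[of c v] c1 by simp

lemma energy_gt_0 [simp]: "0 < energy c v" using energy_ge_1[of v] by simp

lemma C0_nonneg: "0 \<le> C0" using \<sigma>0_bounds[of 0] by (auto intro: order_trans)

lemma kernel_measurable [measurable (raw)]:
  assumes [measurable]: "f \<in> borel_measurable M" "g \<in> borel_measurable M" "w \<in> borel_measurable M"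
  shows "(\<lambda>x. B (f x) (g x) (w x)) \<in> borel_measurable M"
proof -
  have [measurable]: "(\<lambda>x. \<sigma>0 (arccos (cos_angle c (f x) (g x) (w x)))) \<in> borel_measurable M"
    by (rule measurable_compose[OF _ measurable_comp_arccos[OF \<sigma>0_meas]]) measurable
  show ?thesis
    unfolding coll_kernel_def cross_section_def v_phi_def scatter_angle_cos by measurable
qed

text \<open>
  For \<open>\<gamma> \<le> 0\<close> the factor \<open>g\<^sup>\<gamma>\<close> is largest where \<open>g\<close> is small, which is where the lower bound
  \<open>g \<ge> |v - u| / (v\<^sub>0 u\<^sub>0)\<close> enters; the remaining factor is of size \<open>(v\<^sub>0 u\<^sub>0)\<^sup>-\<^sup>1\<^sup>/\<^sup>2\<close> by \<open>s \<le> 4 v\<^sub>0 u\<^sub>0\<close>.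
\<close>
lemma kernel_bound:
  assumes w: "norm w = 1" and "u \<noteq> v"
  shows "\<bar>B v u w\<bar> \<le> c * C0 / 2 * energy c v powr (- \<gamma> - 1/2) * (energy c u powr (- \<gamma> - 1/2) * dist v u powr \<gamma>)"
proof -
  define a where "a = energy c v"
  define b where "b = energy c u"
  define d where "d = dist v u"
  define g where "g = rel_g c v u"
  have ab: "1 \<le> a" "1 \<le> b" by (simp_all add: a_def b_def energy_ge_1)
  have d: "d > 0" using assms by (simp add: d_def)
  have "0 \<le> (a - 1) * (b - 1)" using ab by simp
  moreover have "1 \<le> a * b" using ab by (metis mult_mono' mult_1 zero_le_one)
  ultimately have "a + b \<le> 2 * (a * b)" by (simp add: algebra_simps)
  then have "d / (a * b) \<le> 2 * d / (a + b)" using ab d by (simp add: divide_simps mult_left_mono)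
  also have "\<dots> \<le> 2 * c * norm (v - u) / (a + b)"
    using c1 d ab by (intro divide_right_mono) (auto simp: d_def dist_norm)
  also have "\<dots> \<le> g" unfolding g_def a_def b_def by (rule rel_g_lower[OF c0])
  finally have g: "d / (a * b) \<le> g" .
  have dab: "0 < d / (a * b)" using d ab by simp
  then have g0: "g > 0" using g by simp
  have "sqrt (rel_s c v u) \<le> sqrt (4 * (a * b))" using rel_s_le[OF c0, of v u] by (simp add: a_def b_def)
  then have s: "sqrt (rel_s c v u) \<le> 2 * (a * b) powr (1/2)"
    using ab by (simp add: real_sqrt_mult powr_half_sqrt)
  have "\<bar>cos_angle c v u w\<bar> \<le> 1" by (rule abs_cos_angle_le_1[OF c0 w])
  then have "0 \<le> \<sigma>0 (scatter_angle c v u w) \<and> \<sigma>0 (scatter_angle c v u w) \<le> C0"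
    unfolding scatter_angle_cos using arccos_lbound arccos_ubound by (intro \<sigma>0_bounds) auto
  then have \<sigma>: "\<bar>\<sigma>0 (scatter_angle c v u w)\<bar> \<le> C0" by simp
  have gp: "g * g powr (\<gamma> - 1) = g powr \<gamma>" using g0 by (simp add: powr_mult_base)
  have "\<bar>B v u w\<bar> = c / (4 * (a * b)) * sqrt (rel_s c v u) * (g * g powr (\<gamma> - 1)) * \<bar>\<sigma>0 (scatter_angle c v u w)\<bar>"
    using ab g0 c0 rel_s_pos[OF c0, of v u]
    by (simp add: coll_kernel_def v_phi_def cross_section_def abs_mult flip: a_def b_def g_def) (simp add: ac_simps)
  also have "\<dots> \<le> c / (4 * (a * b)) * (2 * (a * b) powr (1/2)) * ((d / (a * b)) powr \<gamma>) * C0"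
    unfolding gp using s \<sigma> ab c0 g g0 dab \<gamma>_le C0_nonneg rel_s_pos[OF c0, of v u]
    by (intro mult_mono order_refl powr_mono2') auto
  also have "\<dots> = c * C0 / 2 * (((a * b) powr (1/2) / (a * b) powr 1) * (d / (a * b)) powr \<gamma>)"
    using ab by simp
  also have "\<dots> = c * C0 / 2 * ((a * b) powr (- \<gamma> - 1/2) * d powr \<gamma>)"
  proof -
    have "(a * b) powr (1/2) / (a * b) powr 1 * (d / (a * b)) powr \<gamma> = ((a * b) powr (1/2) / (a * b) powr 1 / (a * b) powr \<gamma>) * d powr \<gamma>"
      using d ab by (simp add: powr_divide)
    also have "(a * b) powr (1/2) / (a * b) powr 1 / (a * b) powr \<gamma> = (a * b) powr (- \<gamma> - 1/2)"
    proof -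
      have "1/2 - 1 - \<gamma> = - \<gamma> - 1/2" by simp
      then show ?thesis unfolding powr_diff[symmetric] by (simp only:)
    qed
    finally show ?thesis by simp
  qed
  also have "(a * b) powr (- \<gamma> - 1/2) = a powr (- \<gamma> - 1/2) * b powr (- \<gamma> - 1/2)" using ab by (simp add: powr_mult)
  finally show ?thesis by (simp add: a_def b_def d_def mult.assoc)
qed

text \<open>
  Near \<open>u = v\<close> the kernel is as singular as \<open>|v - u|\<^sup>\<gamma>\<close>, which is integrable in three dimensions
  because \<open>-\<gamma> < 3\<close>. For large \<open>u\<close> the powers of \<open>u\<^sub>0\<close> and \<open>|v - u|\<close> combine to \<open>|v - u|\<^sup>-\<^sup>7\<^sup>/\<^sup>2\<close>
  whatever \<open>\<gamma>\<close> is. This is where cubic decay suffices: the kernel itself contributes the missing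
  half power.
\<close>
lemma kernel_dominated:
  obtains D where "integrable lborel D" "\<And>u. 0 \<le> D u"
    "\<And>u w. norm w = 1 \<Longrightarrow> \<bar>B v u w\<bar> / energy c u ^ 3 \<le> D u"
proof -
  define a where "a = energy c v"
  \<comment> \<open>K collects the powers of the fixed energy; L compares the energy of u with the distance to v in the far region\<close>
  define K where "K = c * C0 / 2 * a powr (- \<gamma> - 1/2)"
  define L where "L = (1 + a) powr (\<gamma> + 7/2)"
  have K: "0 \<le> K" using c0 C0_nonneg by (simp add: K_def)
  define D where "D u = K * (indicator (ball v 1) u * dist v u powr (- (- \<gamma>)))
     + K * L * (indicator (- ball v 1) u * dist v u powr (- (7/2)))" for u
  have "integrable lborel D"
    unfolding D_def using \<gamma>_gt \<gamma>_le
    by (intro Bochner_Integration.integrable_add integrable_mult_right integrable_singular_power integrable_decaying_power) auto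
  moreover have D0: "0 \<le> D u" for u using K by (simp add: D_def L_def)
  moreover have "\<bar>B v u w\<bar> / energy c u ^ 3 \<le> D u" if w: "norm w = 1" for u w
  proof (cases "u = v")
    case True
    have "rel_g c v v = 0" by (simp add: rel_g_sq rel_g_mink mink_four_self)
    then show ?thesis using True D0[of v] by (simp add: coll_kernel_def v_phi_def)
  next
    case False
    define b where "b = energy c u"
    define d where "d = dist v u"
    have ab: "1 \<le> a" "1 \<le> b" by (simp_all add: a_def b_def energy_ge_1)
    have d: "d > 0" using False by (simp add: d_def)
    have "b ^ 3 = b powr 3" using ab by simp
    then have "b powr (- \<gamma> - 1/2) / b ^ 3 = b powr (- \<gamma> - 1/2 - 3)"
      by (simp only: powr_diff)
    moreover have "- \<gamma> - 1/2 - 3 = - \<gamma> - 7/2" by simp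
    ultimately have "b powr (- \<gamma> - 1/2) / b ^ 3 = b powr (- \<gamma> - 7/2)" by (simp only:)
    then have "\<bar>B v u w\<bar> / b ^ 3 \<le> K * (b powr (- \<gamma> - 7/2) * d powr \<gamma>)"
      using divide_right_mono[OF kernel_bound[OF w False], of "b^3"] ab
      by (simp add: K_def a_def b_def d_def mult.assoc) (simp add: field_simps)
    also have "\<dots> \<le> D u"
    proof (cases "d < 1")
      case True
      have "b powr (- \<gamma> - 7/2) \<le> 1" using powr_mono[of "- \<gamma> - 7/2" 0 b] ab \<gamma>_gt by simp
      then have "b powr (- \<gamma> - 7/2) * d powr \<gamma> \<le> d powr \<gamma>" by (simp add: mult_left_le_one_le)
      then show ?thesis using True K by (simp add: D_def d_def mult_left_mono)
    next
      case far: False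
      have "d \<le> norm v + norm u" unfolding d_def dist_norm by (rule norm_triangle_ineq4)
      also have "\<dots> \<le> a + b" using norm_less_energy[OF c0, of v] norm_less_energy[OF c0, of u] by (simp add: a_def b_def)
      also have "\<dots> \<le> (1 + a) * b" using ab by (simp add: algebra_simps)
      finally have "d / (1 + a) \<le> b" using ab by (simp add: divide_simps mult.commute)
      then have "b powr (- \<gamma> - 7/2) \<le> (d / (1 + a)) powr (- \<gamma> - 7/2)"
        using d ab \<gamma>_gt by (intro powr_mono2') auto
      also have "\<dots> = d powr (- \<gamma> - 7/2) * L"
      proof -
        have "L = 1 / (1 + a) powr (- \<gamma> - 7/2)"
          unfolding L_def using powr_minus_divide[of "1 + a" "- \<gamma> - 7/2"] by (simp add: add.commute)
        then show ?thesis using d ab by (simp add: powr_divide)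
      qed
      finally have "b powr (- \<gamma> - 7/2) * d powr \<gamma> \<le> d powr (- \<gamma> - 7/2) * L * d powr \<gamma>"
        by (intro mult_right_mono) auto
      also have "\<dots> = L * d powr (- (7/2))" by (simp add: mult.commute mult.left_commute flip: powr_add)
      finally show ?thesis using far K by (simp add: D_def d_def mult_left_mono mult.assoc)
    qed
    finally show ?thesis by (simp add: b_def)
  qed
  ultimately show ?thesis by (rule that)
qed


section \<open>The collision integral of functions with cubic decay\<close>

text \<open>
  By conservation of energy at least one outgoing particle carries half of the energy, and the other
  one has energy at least \<open>c \<ge> 1\<close>.
\<close>
lemma energy_post_product:
  assumes "norm w = 1"
  shows "energy c u \<le> 2 * (energy c (post_u c v u w) * energy c (post_v c v u w))"
proof -
  have "0 \<le> (energy c (post_u c v u w) - 1) * (energy c (post_v c v u w) - 1)"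
    and "1 \<le> energy c (post_u c v u w) * energy c (post_v c v u w)"
    using energy_ge_1[of "post_u c v u w"] energy_ge_1[of "post_v c v u w"]
    by (simp_all) (metis mult_mono' mult_1 zero_le_one)
  then show ?thesis using energy_post[OF c0 assms, of v u] energy_ge_1[of v]
    by (simp add: algebra_simps)
qed

definition collision :: "real^3 \<Rightarrow> (real^3 \<Rightarrow> real) \<Rightarrow> (real^3 \<Rightarrow> real) \<Rightarrow> (real^3) \<times> (real^3) \<Rightarrow> real" where
  "collision v h f = (\<lambda>(u, w). B v u w * (h (post_u c v u w) * f (post_v c v u w) - h u * f v))"

definition cubic_decay :: "real \<Rightarrow> (real^3 \<Rightarrow> real) \<Rightarrow> bool" where
  "cubic_decay K h \<longleftrightarrow> (\<forall>x. \<bar>h x\<bar> \<le> K / energy c x ^ 3)"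

lemma cubic_decay_nonneg: "cubic_decay K h \<Longrightarrow> 0 \<le> K"
  unfolding cubic_decay_def
  by (metis abs_ge_zero energy_gt_0 order_trans zero_le_divide_iff zero_less_power not_less)

text \<open>
  The gain term decays in \<open>u\<close> as fast as the loss term because \<open>u\<^sub>0 \<le> 2 u\<^sub>0' v\<^sub>0'\<close>; this costs the
  factor 8 and the loss term adds 1.
\<close>
lemma collision_bound:
  assumes h: "cubic_decay K h" and f: "cubic_decay L f" and w: "norm w = 1"
  shows "\<bar>collision v h f (u, w)\<bar> \<le> 9 * K * L * (\<bar>B v u w\<bar> / energy c u ^ 3)"
proof -
  define U where "U = energy c (post_u c v u w)"
  define V where "V = energy c (post_v c v u w)"
  have KL: "0 \<le> K" "0 \<le> L" using h f by (auto intro: cubic_decay_nonneg)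
  have UV: "1 \<le> U" "1 \<le> V" by (simp_all add: U_def V_def energy_ge_1)
  have u: "1 \<le> energy c u" and v: "1 \<le> energy c v" by (rule energy_ge_1)+
  have "energy c u ^ 3 \<le> (2 * (U * V)) ^ 3"
    unfolding U_def V_def using u by (intro power_mono energy_post_product w) auto
  then have "1 / (U * V) ^ 3 \<le> 8 / energy c u ^ 3"
    using UV u by (simp add: power_mult_distrib divide_simps mult.commute)
  then have "K * L * (1 / (U * V) ^ 3) \<le> K * L * (8 / energy c u ^ 3)"
    using KL by (intro mult_left_mono) auto
  moreover have "\<bar>h (post_u c v u w) * f (post_v c v u w)\<bar> \<le> K / U ^ 3 * (L / V ^ 3)"
    unfolding abs_mult U_def V_def using h f KL by (intro mult_mono) (auto simp: cubic_decay_def intro!: divide_nonneg_nonneg zero_le_power less_imp_le[OF energy_gt_0])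
  ultimately have gain: "\<bar>h (post_u c v u w) * f (post_v c v u w)\<bar> \<le> K * L * (8 / energy c u ^ 3)"
    by (simp add: power_mult_distrib)
  have "L / energy c v ^ 3 \<le> L / 1" using KL v by (intro divide_left_mono) auto
  then have "\<bar>f v\<bar> \<le> L" using f by (auto simp: cubic_decay_def intro: order_trans)
  then have loss: "\<bar>h u * f v\<bar> \<le> K / energy c u ^ 3 * L"
    unfolding abs_mult using h KL by (intro mult_mono) (auto simp: cubic_decay_def intro!: divide_nonneg_nonneg zero_le_power less_imp_le[OF energy_gt_0])
  have "\<bar>h (post_u c v u w) * f (post_v c v u w) - h u * f v\<bar> \<le> 9 * K * L / energy c u ^ 3"
  proof -
    have "9 * K * L / energy c u ^ 3 = K * L * (8 / energy c u ^ 3) + K / energy c u ^ 3 * L"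
      using u by (simp add: field_simps)
    then show ?thesis
      using gain loss abs_triangle_ineq4[of "h (post_u c v u w) * f (post_v c v u w)" "h u * f v"] by linarith
  qed
  from mult_left_mono[OF this, of "\<bar>B v u w\<bar>"] show ?thesis
    by (simp add: collision_def abs_mult mult.commute mult.left_commute)
qed

lemma collision_measurable:
  assumes [measurable]: "h \<in> borel_measurable borel" "f \<in> borel_measurable borel"
  shows "collision v h f \<in> borel_measurable (lborel \<Otimes>\<^sub>M sphere_measure)"
  unfolding collision_def by measurable

lemma AE_lborel_sphere_norm: "AE y in (lborel :: (real^3) measure) \<Otimes>\<^sub>M sphere_measure. norm (snd y) = 1"
proof (rule lborel_sphere.AE_pair_measure)
  show "{x \<in> space ((lborel :: (real^3) measure) \<Otimes>\<^sub>M sphere_measure). norm (snd x) = 1} \<in> sets (lborel \<Otimes>\<^sub>M sphere_measure)"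
    by measurable
qed (simp add: AE_sphere_norm)

lemma dominating_function:
  obtains D where "integrable (lborel \<Otimes>\<^sub>M sphere_measure) D" "\<And>y. 0 \<le> D y"
    "\<And>u w. norm w = 1 \<Longrightarrow> \<bar>B v u w\<bar> / energy c u ^ 3 \<le> D (u, w)"
proof -
  obtain D where D: "integrable lborel D" "\<And>u. 0 \<le> D u"
    "\<And>u w. norm w = 1 \<Longrightarrow> \<bar>B v u w\<bar> / energy c u ^ 3 \<le> D u"
    using kernel_dominated[of v] by blast
  have [measurable]: "D \<in> borel_measurable borel" using D(1) by auto
  have "integrable (lborel \<Otimes>\<^sub>M sphere_measure) (\<lambda>(u, w). D u)"
    using D(1) by (intro lborel_sphere.Fubini_integrable) auto
  then show thesis using D by (intro that[of "\<lambda>(u, w). D u"]) auto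
qed

lemma collision_integrable:
  assumes "cubic_decay K h" "cubic_decay L f" "h \<in> borel_measurable borel" "f \<in> borel_measurable borel"
  shows "integrable (lborel \<Otimes>\<^sub>M sphere_measure) (collision v h f)"
proof -
  obtain D where D: "integrable (lborel \<Otimes>\<^sub>M sphere_measure) D" "\<And>y. 0 \<le> D y"
    "\<And>u w. norm w = 1 \<Longrightarrow> \<bar>B v u w\<bar> / energy c u ^ 3 \<le> D (u, w)"
    using dominating_function[of v] by blast
  have KL: "0 \<le> K" "0 \<le> L" using assms by (auto intro: cubic_decay_nonneg)
  show ?thesis
  proof (rule Bochner_Integration.integrable_bound)
    show "integrable (lborel \<Otimes>\<^sub>M sphere_measure) (\<lambda>y. 9 * K * L * D y)" using D(1) by simp
    show "AE y in lborel \<Otimes>\<^sub>M sphere_measure. norm (collision v h f y) \<le> norm (9 * K * L * D y)"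
      using AE_lborel_sphere_norm
    proof eventually_elim
      case (elim y)
      obtain u w where y: "y = (u, w)" by (cases y)
      have w: "norm w = 1" using elim y by simp
      have "\<bar>collision v h f (u, w)\<bar> \<le> 9 * K * L * (\<bar>B v u w\<bar> / energy c u ^ 3)"
        by (rule collision_bound[OF assms(1,2) w])
      also have "\<dots> \<le> 9 * K * L * D (u, w)" using D(3)[OF w] KL by (intro mult_left_mono) auto
      finally show ?case unfolding y using D(2)[of "(u, w)"] KL by simp
    qed
  qed (rule collision_measurable[OF assms(3,4)])
qed

lemma Q_eq_integral_collision:
  assumes "integrable (lborel \<Otimes>\<^sub>M sphere_measure) (collision v h f)"
  shows "Q h f v = (LINT y|(lborel \<Otimes>\<^sub>M sphere_measure). collision v h f y)"
  using lborel_sphere.integral_fst'[OF assms] by (simp add: Q_vel_def collision_def)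

text \<open>
  Bilinearity in the form needed to turn Lipschitz bounds of the two factors into one of the integrand.
\<close>
lemma collision_diff:
  "collision v h f y - collision v h' f' y = collision v (\<lambda>x. h x - h' x) f y + collision v h' (\<lambda>x. f x - f' x) y"
  by (simp add: collision_def split: prod.split) (simp add: algebra_simps)

text \<open>
  The Leibniz rule for the collision integral when both arguments depend on a parameter and \<open>v\<close> is
  kept fixed. All the bounds have the same cubic decay, so a single dominating function serves.
\<close>
theorem Q_has_derivative:
  fixes H F :: "'p::real_normed_vector \<Rightarrow> real^3 \<Rightarrow> real"
  assumes e: "e > 0"
    and meas: "\<And>p. p \<in> ball p0 e \<Longrightarrow> H p \<in> borel_measurable borel" "\<And>p. p \<in> ball p0 e \<Longrightarrow> F p \<in> borel_measurable borel"
    and decay: "\<And>p. p \<in> ball p0 e \<Longrightarrow> cubic_decay K (H p)" "\<And>p. p \<in> ball p0 e \<Longrightarrow> cubic_decay K (F p)"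
    and lip: "\<And>p. p \<in> ball p0 e \<Longrightarrow> cubic_decay (K * norm (p - p0)) (\<lambda>x. H p x - H p0 x)"
      "\<And>p. p \<in> ball p0 e \<Longrightarrow> cubic_decay (K * norm (p - p0)) (\<lambda>x. F p x - F p0 x)"
    and der: "\<And>x. ((\<lambda>p. H p x) has_derivative H' x) (at p0)" "\<And>x. ((\<lambda>p. F p x) has_derivative F' x) (at p0)"
  shows "((\<lambda>p. Q (H p) (F p) v) has_derivative
    (\<lambda>\<pi>. Q (\<lambda>x. H' x \<pi>) (F p0) v + Q (H p0) (\<lambda>x. F' x \<pi>) v)) (at p0)"
proof -
  let ?M = "lborel \<Otimes>\<^sub>M sphere_measure :: ((real^3) \<times> (real^3)) measure"
  have p0: "p0 \<in> ball p0 e" using e by simp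
  obtain D where D: "integrable ?M D" "\<And>y. 0 \<le> D y"
    "\<And>u w. norm w = 1 \<Longrightarrow> \<bar>B v u w\<bar> / energy c u ^ 3 \<le> D (u, w)"
    using dominating_function[of v] by blast
  have K: "0 \<le> K" using decay(1)[OF p0] by (rule cubic_decay_nonneg)
  define k where "k p = collision v (H p) (F p)" for p
  define k' where "k' y \<pi> = collision v (\<lambda>x. H' x \<pi>) (F p0) y + collision v (H p0) (\<lambda>x. F' x \<pi>) y" for y \<pi>
  have int: "integrable ?M (k p)" if "p \<in> ball p0 e" for p
    unfolding k_def by (rule collision_integrable[OF decay(1)[OF that] decay(2)[OF that] meas(1)[OF that] meas(2)[OF that]])
  have bound': "cubic_decay (K * norm \<pi>) (\<lambda>x. H' x \<pi>)" "cubic_decay (K * norm \<pi>) (\<lambda>x. F' x \<pi>)" for \<pi>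
  proof -
    have "\<bar>H' x \<pi>\<bar> \<le> K / energy c x ^ 3 * norm \<pi>" for x
      by (rule has_derivative_lipschitz_bound[OF e _ der(1)]) (use lip(1) in \<open>simp add: cubic_decay_def\<close>)
    moreover have "\<bar>F' x \<pi>\<bar> \<le> K / energy c x ^ 3 * norm \<pi>" for x
      by (rule has_derivative_lipschitz_bound[OF e _ der(2)]) (use lip(2) in \<open>simp add: cubic_decay_def\<close>)
    ultimately show "cubic_decay (K * norm \<pi>) (\<lambda>x. H' x \<pi>)" "cubic_decay (K * norm \<pi>) (\<lambda>x. F' x \<pi>)"
      by (simp_all add: cubic_decay_def)
  qed
  have meas': "(\<lambda>x. H' x \<pi>) \<in> borel_measurable borel" "(\<lambda>x. F' x \<pi>) \<in> borel_measurable borel" for \<pi>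
    using borel_measurable_derivative[OF e meas(1) der(1)] borel_measurable_derivative[OF e meas(2) der(2)] by blast+
  have int1: "integrable ?M (collision v (\<lambda>x. H' x \<pi>) (F p0))" and int2: "integrable ?M (collision v (H p0) (\<lambda>x. F' x \<pi>))" for \<pi>
    using collision_integrable[OF bound'(1) decay(2)[OF p0] meas'(1) meas(2)[OF p0]]
      collision_integrable[OF decay(1)[OF p0] bound'(2) meas(1)[OF p0] meas'(2)] by auto
  have "((\<lambda>p. LINT y|?M. k p y) has_derivative (\<lambda>\<pi>. LINT y|?M. k' y \<pi>)) (at p0)"
  proof (rule has_derivative_lebesgue_integral[OF e int])
    \<comment> \<open>twice the constant 9 of a single collision term, one for each factor that is varied\<close>
    show "integrable ?M (\<lambda>y. 18 * K * K * D y)" using D(1) by simp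
    show "AE y in ?M. \<forall>p\<in>ball p0 e. \<bar>k p y - k p0 y\<bar> \<le> 18 * K * K * D y * norm (p - p0)"
      using AE_lborel_sphere_norm
    proof eventually_elim
      case (elim y)
      obtain u w where y: "y = (u, w)" by (cases y)
      have w: "norm w = 1" using elim y by simp
      show ?case
      proof
        fix p assume p: "p \<in> ball p0 e"
        have "\<bar>k p y - k p0 y\<bar> \<le> 9 * (K * norm (p - p0)) * K * (\<bar>B v u w\<bar> / energy c u ^ 3) + 9 * K * (K * norm (p - p0)) * (\<bar>B v u w\<bar> / energy c u ^ 3)"
          unfolding k_def collision_diff y
          by (intro order_trans[OF abs_triangle_ineq] add_mono collision_bound lip decay p p0 w)
        also have "\<dots> = 18 * K * K * norm (p - p0) * (\<bar>B v u w\<bar> / energy c u ^ 3)" by simp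
        also have "\<dots> \<le> 18 * K * K * norm (p - p0) * D (u, w)"
          using D(3)[OF w] K by (intro mult_left_mono) auto
        finally show "\<bar>k p y - k p0 y\<bar> \<le> 18 * K * K * D y * norm (p - p0)" by (simp add: y mult_ac)
      qed
    qed
    fix y :: "(real^3) \<times> (real^3)"
    obtain u w where y: "y = (u, w)" by (cases y)
    show "((\<lambda>p. k p y) has_derivative k' y) (at p0)"
      unfolding k_def k'_def[abs_def] y collision_def prod.case
      by (rule has_derivative_eq_rhs, (rule derivative_intros der)+) (auto simp: algebra_simps)
  qed
  also have "(\<lambda>\<pi>. LINT y|?M. k' y \<pi>) = (\<lambda>\<pi>. Q (\<lambda>x. H' x \<pi>) (F p0) v + Q (H p0) (\<lambda>x. F' x \<pi>) v)"
    by (simp add: k'_def Q_eq_integral_collision int1 int2 fun_eq_iff)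
  finally show ?thesis
    by (rule has_derivative_transform_within_open[OF _ open_ball p0])
       (simp add: k_def Q_eq_integral_collision int[unfolded k_def])
qed

section \<open>Lorentz covariance of the collision operator\<close>

lemma kernel_covariant:
  assumes T: "lorentz c T"
    and v: "post_v c (vel_map c T v) (vel_map c T u) w' = vel_map c T (post_v c v u w)"
    and u: "post_u c (vel_map c T v) (vel_map c T u) w' = vel_map c T (post_u c v u w)"
  shows "B (vel_map c T v) (vel_map c T u) w' =
    energy c v * energy c u / (energy c (vel_map c T v) * energy c (vel_map c T u)) * B v u w"
proof -
  have lin: "linear T" and mink: "\<And>X Y. mink (T X) (T Y) = mink X Y" using T by (auto simp: lorentz_def)
  have "cos_angle c (vel_map c T v) (vel_map c T u) w' = cos_angle c v u w"
    unfolding cos_angle_mink v u rel_vel_map[OF T] lorentz_four[OF T, symmetric] linear_diff[OF lin, symmetric] mink ..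
  then have "cross_section \<gamma> \<sigma>0 (rel_g c (vel_map c T v) (vel_map c T u)) (scatter_angle c (vel_map c T v) (vel_map c T u) w') =
      cross_section \<gamma> \<sigma>0 (rel_g c v u) (scatter_angle c v u w)"
    by (simp add: scatter_angle_cos rel_vel_map[OF T])
  then show ?thesis
    using less_imp_neq[OF energy_gt_0, of v] less_imp_neq[OF energy_gt_0, of u]
    by (simp add: coll_kernel_def v_phi_def rel_vel_map[OF T])
qed

text \<open>
  In \<open>v\<^sub>0 Q(h, f)(v)\<close> the factor \<open>1 / (v\<^sub>0 u\<^sub>0)\<close> of the kernel combines with \<open>v\<^sub>0 du\<close> to the invariant
  measure \<open>du / u\<^sub>0\<close>; the rest of the kernel is a function of Minkowski products. Substituting
  \<open>u = \<phi> u*\<close> with the velocity map \<open>\<phi>\<close> of \<open>T\<close> and rotating \<open>\<omega>\<close> moves \<open>\<phi>\<close> into the two arguments.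
\<close>
theorem Q_covariant:
  assumes T: "lorentz c T" and inv: "preserves_invariant_measure c (vel_map c T)"
    and [measurable]: "h \<in> borel_measurable borel" "f \<in> borel_measurable borel"
  shows "energy c (vel_map c T v) * Q h f (vel_map c T v) =
    energy c v * Q (\<lambda>x. h (vel_map c T x)) (\<lambda>x. f (vel_map c T x)) v"
proof -
  let ?\<phi> = "vel_map c T"
  let ?J = "\<lambda>u. energy c (?\<phi> u) / energy c u"
  have [measurable]: "?\<phi> \<in> borel \<rightarrow>\<^sub>M borel" using inv by (simp add: preserves_invariant_measure_def)
  \<comment> \<open>k is the integrand before and l, up to the energy factors, the one after the substitution\<close>
  define k where "k u w = B (?\<phi> v) u w * (h (post_u c (?\<phi> v) u w) * f (post_v c (?\<phi> v) u w) - h u * f (?\<phi> v))" for u w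
  define l where "l u w = B v u w * (h (?\<phi> (post_u c v u w)) * f (?\<phi> (post_v c v u w)) - h (?\<phi> u) * f (?\<phi> v))" for u w
  have k_meas [measurable]: "(\<lambda>(u, w). k u w) \<in> borel_measurable (borel \<Otimes>\<^sub>M borel)"
    unfolding k_def by measurable
  have l_meas [measurable]: "l u \<in> borel_measurable borel" for u
    unfolding l_def[abs_def] by measurable
  define G where "G u = (LINT w|sphere_measure. k u w)" for u
  have G [measurable]: "G \<in> borel_measurable borel"
    unfolding G_def[abs_def] by (rule sphere.borel_measurable_lebesgue_integral) (simp cong: measurable_cong_sets)
  have GJ: "?J u * G (?\<phi> u) = energy c v / energy c (?\<phi> v) * (LINT w|sphere_measure. l u w)" for u
  proof -
    obtain R where R: "orthogonal_transformation R"
      "\<And>w. norm w = 1 \<Longrightarrow> post_v c (?\<phi> v) (?\<phi> u) (R w) = ?\<phi> (post_v c v u w)"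
      "\<And>w. norm w = 1 \<Longrightarrow> post_u c (?\<phi> v) (?\<phi> u) (R w) = ?\<phi> (post_u c v u w)"
      using wigner_rotation[OF c0 T, of v u] by blast
    note [measurable] = orthogonal_measurable[OF R(1)]
    have ku [measurable]: "k (?\<phi> u) \<in> borel_measurable borel"
      using measurable_Pair2[OF k_meas, of "?\<phi> u"] by simp
    have "G (?\<phi> u) = (LINT w|sphere_measure. k (?\<phi> u) (R w))"
      unfolding G_def by (rule sphere_integral_rotation[OF R(1) ku, symmetric])
    also have "\<dots> = (LINT w|sphere_measure. energy c v * energy c u / (energy c (?\<phi> v) * energy c (?\<phi> u)) * l u w)"
    proof (rule integral_cong_AE)
      show "AE w in sphere_measure. k (?\<phi> u) (R w) = energy c v * energy c u / (energy c (?\<phi> v) * energy c (?\<phi> u)) * l u w"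
        using AE_sphere_norm
      proof eventually_elim
        case (elim w)
        show ?case
          unfolding k_def l_def R(2)[OF elim] R(3)[OF elim] kernel_covariant[OF T R(2)[OF elim] R(3)[OF elim]]
          by simp
      qed
    qed measurable
    also have "\<dots> = energy c v * energy c u / (energy c (?\<phi> v) * energy c (?\<phi> u)) * (LINT w|sphere_measure. l u w)"
      by (rule integral_mult_right_zero)
    finally show ?thesis
      using less_imp_neq[OF energy_gt_0, of u] less_imp_neq[OF energy_gt_0, of "?\<phi> u"] by simp
  qed
  have "Q h f (?\<phi> v) = (LINT u|lborel. G u)" by (simp add: Q_vel_def G_def k_def)
  also have "\<dots> = (LINT u|distr (density lborel (\<lambda>u. ennreal (?J u))) borel ?\<phi>. G u)"
    using inv by (simp add: preserves_invariant_measure_def)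
  also have "\<dots> = (LINT u|density lborel (\<lambda>u. ennreal (?J u)). G (?\<phi> u))"
    by (rule integral_distr) measurable
  also have "\<dots> = (LINT u|lborel. ?J u *\<^sub>R G (?\<phi> u))"
    by (rule integral_density) (auto simp: less_imp_le)
  also have "\<dots> = (LINT u|lborel. energy c v / energy c (?\<phi> v) * (LINT w|sphere_measure. l u w))"
    by (simp only: real_scaleR_def GJ)
  also have "\<dots> = energy c v / energy c (?\<phi> v) * (LINT u|lborel. LINT w|sphere_measure. l u w)"
    by (rule integral_mult_right_zero)
  also have "(LINT u|lborel. LINT w|sphere_measure. l u w) = Q (\<lambda>x. h (?\<phi> x)) (\<lambda>x. f (?\<phi> x)) v"
    by (simp add: Q_vel_def l_def)
  finally show ?thesis using less_imp_neq[OF energy_gt_0, of "?\<phi> v"] by simp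
qed

end


section \<open>Admissible functions along families of Lorentz maps\<close>

abbreviation D_phase :: "(phase \<Rightarrow> real) \<Rightarrow> phase \<Rightarrow> phase \<Rightarrow> real" where
  "D_phase f z \<equiv> frechet_derivative f (at z)"

lemma smooth_has_derivative: "smooth f \<Longrightarrow> (f has_derivative frechet_derivative f (at z)) (at z)"
  unfolding smooth_def using C_k.simps(2)[of 0 f]
  by (metis UNIV_I differentiable_on_def frechet_derivative_works)

lemma smooth_continuous: "smooth f \<Longrightarrow> continuous_on UNIV f"
  unfolding smooth_def using C_k.simps(1)[of f] by blast

lemma vec_axis_expansion: "(\<Sum>i\<in>UNIV. b $ i *\<^sub>R axis i 1) = (b :: real^'n)"
  by (simp add: vec_eq_iff axis_def if_distrib[where f = "\<lambda>x. _ * x"] cong: if_cong)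

lemma D_phase_expansion:
  assumes "f differentiable (at z)"
  shows "D_phase f z (a, b, w) = a * d_t f z + (\<Sum>i\<in>UNIV. b $ i * d_x i f z) + (\<Sum>i\<in>UNIV. w $ i * d_v i f z)"
proof -
  have lin: "linear (D_phase f z)" using assms by (rule linear_frechet_derivative)
  have "(a, b, w) = a *\<^sub>R (1, 0, 0) + (\<Sum>i\<in>UNIV. b $ i *\<^sub>R (0, axis i 1, 0)) + (\<Sum>i\<in>UNIV. w $ i *\<^sub>R (0, 0, axis i 1))"
    by (simp add: prod_eq_iff fst_sum snd_sum vec_axis_expansion)
  then show ?thesis
    by (simp only: real_scaleR_def linear_add[OF lin] linear_cmul[OF lin] linear_sum[OF lin] d_t_def d_x_def d_v_def)
qed

lemma v_decay_bound:
  assumes "v_decay c f" "compact K"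
  obtains C where "0 \<le> C" "\<And>t x v. (t, x) \<in> K \<Longrightarrow> \<bar>f (t, x, v)\<bar> \<le> C / energy c v ^ 3"
proof -
  obtain C where C: "\<forall>(t, x)\<in>K. \<forall>v. \<bar>f (t, x, v)\<bar> \<le> C / energy c v ^ 3"
    using assms unfolding v_decay_def by blast
  have e: "0 \<le> energy c v" for v by (simp add: energy_def)
  show thesis
  proof (rule that[of "\<bar>C\<bar>"])
    fix t x v assume "(t, x) \<in> K"
    then have "\<bar>f (t, x, v)\<bar> \<le> C / energy c v ^ 3" using C by blast
    also have "\<dots> \<le> \<bar>C\<bar> / energy c v ^ 3" using e[of v] by (intro divide_right_mono) auto
    finally show "\<bar>f (t, x, v)\<bar> \<le> \<bar>C\<bar> / energy c v ^ 3" .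
  qed simp
qed

lemma v_decay_bound_finite:
  fixes g :: "3 \<Rightarrow> phase \<Rightarrow> real"
  assumes "\<And>i. v_decay c (g i)" "compact K"
  obtains C where "0 \<le> C" "\<And>i t x v. (t, x) \<in> K \<Longrightarrow> \<bar>g i (t, x, v)\<bar> \<le> C / energy c v ^ 3"
proof -
  have "\<exists>C. 0 \<le> C \<and> (\<forall>t x v. (t, x) \<in> K \<longrightarrow> \<bar>g i (t, x, v)\<bar> \<le> C / energy c v ^ 3)" for i
    using v_decay_bound[OF assms(1)[of i] assms(2)] by metis
  then obtain C where C: "\<And>i. 0 \<le> C i" "\<And>i t x v. (t, x) \<in> K \<Longrightarrow> \<bar>g i (t, x, v)\<bar> \<le> C i / energy c v ^ 3"
    by metis
  have e: "0 \<le> energy c v" for v by (simp add: energy_def)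
  show thesis
  proof (rule that[of "\<Sum>i\<in>UNIV. C i"])
    show "0 \<le> (\<Sum>i\<in>UNIV. C i)" by (intro sum_nonneg C)
    fix i t x v assume "(t, x) \<in> K"
    then have "\<bar>g i (t, x, v)\<bar> \<le> C i / energy c v ^ 3" by (rule C)
    also have "\<dots> \<le> (\<Sum>i\<in>UNIV. C i) / energy c v ^ 3"
      using e[of v] C(1) by (intro divide_right_mono member_le_sum) auto
    finally show "\<bar>g i (t, x, v)\<bar> \<le> (\<Sum>i\<in>UNIV. C i) / energy c v ^ 3" .
  qed
qed

context collision_kernel
begin

text \<open>
  Since \<open>(v\<^sub>0 / c) d_v i f\<close> is the boost field minus terms with \<open>d_t f\<close> and \<open>d_x i f\<close>, the velocity
  derivatives gain one more power of \<open>v\<^sub>0\<close>. This extra power is what pays for the growth of the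
  velocity fields generating boosts and rotations.
\<close>
lemma admissible_bounds:
  assumes adm: "admissible c f" and K: "compact K"
  obtains C where "0 \<le> C"
    "\<And>t x w. (t, x) \<in> K \<Longrightarrow> \<bar>f (t, x, w)\<bar> \<le> C / energy c w ^ 3"
    "\<And>t x w a b \<pi>. (t, x) \<in> K \<Longrightarrow>
       \<bar>D_phase f (t, x, w) (a, b, \<pi>)\<bar> \<le> C / energy c w ^ 3 * (\<bar>a\<bar> + norm b + norm \<pi> / energy c w)"
proof -
  have sm: "smooth f" using adm by (simp add: admissible_def)
  obtain C1 where C1: "0 \<le> C1" "\<And>t x v. (t, x) \<in> K \<Longrightarrow> \<bar>f (t, x, v)\<bar> \<le> C1 / energy c v ^ 3"
    by (rule v_decay_bound[of c f, OF _ K]) (use adm in \<open>auto simp: admissible_def\<close>)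
  obtain C2 where C2: "0 \<le> C2" "\<And>t x v. (t, x) \<in> K \<Longrightarrow> \<bar>d_t f (t, x, v)\<bar> \<le> C2 / energy c v ^ 3"
    by (rule v_decay_bound[of c "d_t f", OF _ K]) (use adm in \<open>auto simp: admissible_def\<close>)
  obtain C3 where C3: "0 \<le> C3" "\<And>i t x v. (t, x) \<in> K \<Longrightarrow> \<bar>d_x i f (t, x, v)\<bar> \<le> C3 / energy c v ^ 3"
    by (rule v_decay_bound_finite[of c "\<lambda>i. d_x i f", OF _ K]) (use adm in \<open>auto simp: admissible_def\<close>)
  obtain C4 where C4: "0 \<le> C4" "\<And>i t x v. (t, x) \<in> K \<Longrightarrow> \<bar>Omega_boost c i f (t, x, v)\<bar> \<le> C4 / energy c v ^ 3"
    by (rule v_decay_bound_finite[of c "\<lambda>i. Omega_boost c i f", OF _ K]) (use adm in \<open>auto simp: admissible_def\<close>)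
  obtain M where M: "\<And>z. z \<in> K \<Longrightarrow> norm z \<le> M" "0 \<le> M"
    using compact_imp_bounded[OF K] unfolding bounded_iff by (metis abs_ge_zero abs_ge_self order_trans)
  \<comment> \<open>bounds the velocity derivatives multiplied by the energy, after solving the boost field for them\<close>
  define C5 where "C5 = c * (C4 + M * C3 + M * C2)"
  have C5: "0 \<le> C5" using c0 C2 C3 C4 M by (simp add: C5_def)
  define C where "C = C1 + C2 + 3 * C3 + 3 * C5"
  show thesis
  proof (rule that[of C])
    show "0 \<le> C" using C1 C2 C3 C5 by (simp add: C_def)
    fix t x w assume tx: "(t, x) \<in> K"
    let ?r = "1 / energy c w ^ 3"
    have r: "0 \<le> ?r" using energy_gt_0[of w] by (simp add: less_imp_le)
    have "C1 * ?r \<le> C * ?r" using C2 C3 C5 by (intro mult_right_mono[OF _ r]) (simp add: C_def)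
    then show "\<bar>f (t, x, w)\<bar> \<le> C / energy c w ^ 3" using C1(2)[OF tx, of w] by simp
    have tM: "\<bar>t\<bar> \<le> M" and xM: "\<bar>x $ i\<bar> \<le> M" for i
      using M(1)[OF tx] norm_fst_le[of t x] norm_snd_le[of x t] component_le_norm_cart[of x i] by auto
    have dv: "\<bar>d_v i f (t, x, w)\<bar> \<le> C5 * ?r / energy c w" for i
    proof -
      have "energy c w / c * d_v i f (t, x, w) =
          Omega_boost c i f (t, x, w) - t * d_x i f (t, x, w) - 1 / c\<^sup>2 * x $ i * d_t f (t, x, w)"
        by (simp add: Omega_boost_def)
      also have "\<bar>\<dots>\<bar> \<le> C4 * ?r + M * (C3 * ?r) + 1 * M * (C2 * ?r)"
      proof (intro order_trans[OF abs_triangle_ineq4] add_mono)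
        show "\<bar>Omega_boost c i f (t, x, w)\<bar> \<le> C4 * ?r" using C4(2)[OF tx] by simp
        show "\<bar>t * d_x i f (t, x, w)\<bar> \<le> M * (C3 * ?r)"
          unfolding abs_mult using tM C3(2)[OF tx, of i w] M(2) by (intro mult_mono) auto
        have "\<bar>1 / c\<^sup>2\<bar> \<le> 1" using one_le_power[OF c1, of 2] by (simp add: divide_le_eq_1)
        then show "\<bar>1 / c\<^sup>2 * x $ i * d_t f (t, x, w)\<bar> \<le> 1 * M * (C2 * ?r)"
          unfolding abs_mult using xM[of i] C2(2)[OF tx, of w] M(2) by (intro mult_mono) auto
      qed
      also have "\<dots> = (C4 + M * C3 + M * C2) * ?r"
        by (simp add: algebra_simps add_divide_distrib)
      finally have "energy c w / c * \<bar>d_v i f (t, x, w)\<bar> \<le> (C4 + M * C3 + M * C2) * ?r"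
        using c0 energy_gt_0[of w] by (simp add: abs_mult)
      then have "c / energy c w * (energy c w / c * \<bar>d_v i f (t, x, w)\<bar>) \<le> c / energy c w * ((C4 + M * C3 + M * C2) * ?r)"
        using c0 energy_gt_0[of w] by (intro mult_left_mono) (auto simp: less_imp_le)
      then show ?thesis using c0 less_imp_neq[OF energy_gt_0[of w]] by (simp add: C5_def mult.commute)
    qed
    fix a b \<pi>
    have diff: "f differentiable (at (t, x, w))" using smooth_has_derivative[OF sm] by (auto simp: differentiable_def)
    have "\<bar>D_phase f (t, x, w) (a, b, \<pi>)\<bar> \<le>
        \<bar>a * d_t f (t, x, w)\<bar> + (\<Sum>i\<in>UNIV. \<bar>b $ i * d_x i f (t, x, w)\<bar>) + (\<Sum>i\<in>UNIV. \<bar>\<pi> $ i * d_v i f (t, x, w)\<bar>)"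
      unfolding D_phase_expansion[OF diff]
      by (intro order_trans[OF abs_triangle_ineq] add_mono sum_abs order_refl)
    also have "\<dots> \<le> \<bar>a\<bar> * (C2 * ?r) + (\<Sum>i\<in>(UNIV::3 set). norm b * (C3 * ?r)) + (\<Sum>i\<in>(UNIV::3 set). norm \<pi> * (C5 * ?r / energy c w))"
      unfolding abs_mult using C2(2)[OF tx, of w] C3(2)[OF tx, of _ w] dv
      by (intro add_mono sum_mono mult_mono) (auto simp: component_le_norm_cart)
    also have "\<dots> = C2 * ?r * \<bar>a\<bar> + (3 * C3) * ?r * norm b + (3 * C5) * ?r * (norm \<pi> / energy c w)"
      by (simp add: mult_ac)
    also have "\<dots> \<le> C * ?r * \<bar>a\<bar> + C * ?r * norm b + C * ?r * (norm \<pi> / energy c w)"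
      using C1 C2 C3 C5 r energy_gt_0[of w] by (intro add_mono mult_right_mono) (auto simp: C_def less_imp_le)
    also have "\<dots> = C * ?r * (\<bar>a\<bar> + norm b + norm \<pi> / energy c w)" by (simp add: distrib_left)
    finally show "\<bar>D_phase f (t, x, w) (a, b, \<pi>)\<bar> \<le> C / energy c w ^ 3 * (\<bar>a\<bar> + norm b + norm \<pi> / energy c w)" by simp
  qed
qed

text \<open>
  A family of maps \<open>G p\<close> from velocities to phase space, with derivative \<open>G'\<close> in the parameter \<open>p\<close>,
  as produced by moving a point of phase space with Lorentz maps: space-time stays in a compact set,
  energies shrink at most by the factor \<open>M\<close>, and the velocity component moves at a speed
  at most proportional to the energy.
\<close>
definition transport_family ::
  "'p::real_normed_vector \<Rightarrow> real \<Rightarrow> (real \<times> (real^3)) set \<Rightarrow> real \<Rightarrow> ('p \<Rightarrow> real^3 \<Rightarrow> phase) \<Rightarrow> ('p \<Rightarrow> real^3 \<Rightarrow> 'p \<Rightarrow> phase) \<Rightarrow> bool" where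
  "transport_family p0 e K M G G' \<longleftrightarrow> e > 0 \<and> compact K \<and> 1 \<le> M \<and> (\<forall>p\<in>ball p0 e.
     continuous_on UNIV (G p) \<and>
     (\<forall>w. (fst (G p w), fst (snd (G p w))) \<in> K \<and>
       energy c w \<le> M * energy c (snd (snd (G p w))) \<and>
       ((\<lambda>p. G p w) has_derivative G' p w) (at p) \<and>
       (\<forall>h. \<bar>fst (G' p w h)\<bar> \<le> M * norm h \<and> norm (fst (snd (G' p w h))) \<le> M * norm h \<and>
          norm (snd (snd (G' p w h))) \<le> M * energy c w * norm h)))"

text \<open>
  The growth of the velocity component with the energy is compensated by the additional decay of the
  velocity derivatives, so the transported function is Lipschitz in the parameter with cubic decay in \<open>w\<close>.
\<close>
lemma transported_profile:
  assumes fam: "transport_family p0 e K M G G'" and adm: "admissible c f"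
  obtains L where "0 \<le> L"
    "\<And>p. p \<in> ball p0 e \<Longrightarrow> (\<lambda>w. f (G p w)) \<in> borel_measurable borel"
    "\<And>p. p \<in> ball p0 e \<Longrightarrow> cubic_decay L (\<lambda>w. f (G p w))"
    "\<And>p. p \<in> ball p0 e \<Longrightarrow> cubic_decay (L * norm (p - p0)) (\<lambda>w. f (G p w) - f (G p0 w))"
    "\<And>w. ((\<lambda>p. f (G p w)) has_derivative (\<lambda>h. D_phase f (G p0 w) (G' p0 w h))) (at p0)"
proof -
  have e: "e > 0" "compact K" "1 \<le> M" using fam by (auto simp: transport_family_def)
  have cont: "p \<in> ball p0 e \<Longrightarrow> continuous_on UNIV (G p)"
    and inK: "p \<in> ball p0 e \<Longrightarrow> (fst (G p w), fst (snd (G p w))) \<in> K"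
    and en: "p \<in> ball p0 e \<Longrightarrow> energy c w \<le> M * energy c (snd (snd (G p w)))"
    and der: "p \<in> ball p0 e \<Longrightarrow> ((\<lambda>p. G p w) has_derivative G' p w) (at p)"
    and G'1: "p \<in> ball p0 e \<Longrightarrow> \<bar>fst (G' p w h)\<bar> \<le> M * norm h"
    and G'2: "p \<in> ball p0 e \<Longrightarrow> norm (fst (snd (G' p w h))) \<le> M * norm h"
    and G'3: "p \<in> ball p0 e \<Longrightarrow> norm (snd (snd (G' p w h))) \<le> M * energy c w * norm h" for p w h
    using fam unfolding transport_family_def by blast+
  have sm: "smooth f" using adm by (simp add: admissible_def)
  obtain C where C: "0 \<le> C" "\<And>t x w. (t, x) \<in> K \<Longrightarrow> \<bar>f (t, x, w)\<bar> \<le> C / energy c w ^ 3"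
    "\<And>t x w a b \<pi>. (t, x) \<in> K \<Longrightarrow>
       \<bar>D_phase f (t, x, w) (a, b, \<pi>)\<bar> \<le> C / energy c w ^ 3 * (\<bar>a\<bar> + norm b + norm \<pi> / energy c w)"
    using admissible_bounds[OF adm e(2)] by blast
  \<comment> \<open>the factor M cubed compares the two energies; 2 M comes from the motion in space-time and M squared from the motion in velocity\<close>
  define L where "L = C * M ^ 3 * (1 + 2 * M + M\<^sup>2)"
  have L0: "0 \<le> L" using C(1) e(3) by (simp add: L_def)
  have CL: "C * M ^ 3 \<le> L" "C * M ^ 3 * (2 * M + M\<^sup>2) \<le> L"
    using C(1) e(3) by (simp_all add: L_def mult_left_le mult_left_mono algebra_simps)
  have pow: "C / energy c (snd (snd (G p w))) ^ 3 \<le> C * M ^ 3 / energy c w ^ 3" if "p \<in> ball p0 e" for p w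
  proof -
    have "energy c w ^ 3 \<le> (M * energy c (snd (snd (G p w)))) ^ 3"
      by (intro power_mono en that) (simp add: less_imp_le)
    then have "C * energy c w ^ 3 \<le> C * (M ^ 3 * energy c (snd (snd (G p w))) ^ 3)"
      using C(1) by (intro mult_left_mono) (auto simp: power_mult_distrib)
    then show ?thesis by (simp add: divide_simps mult.assoc)
  qed
  have derf: "((\<lambda>p. f (G p w)) has_derivative (\<lambda>h. D_phase f (G p w) (G' p w h))) (at p)" if "p \<in> ball p0 e" for p w
    using has_derivative_compose[OF der[OF that] smooth_has_derivative[OF sm]] .
  have bound: "\<bar>D_phase f (G p w) (G' p w h)\<bar> \<le> L / energy c w ^ 3 * norm h" if p: "p \<in> ball p0 e" for p w h
  proof -
    obtain t x v where G: "G p w = (t, x, v)" by (metis surj_pair)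
    obtain a b \<pi> where G': "G' p w h = (a, b, \<pi>)" by (metis surj_pair)
    have v: "energy c w \<le> M * energy c v" using en[OF p, of w] by (simp add: G)
    have "norm \<pi> / energy c v \<le> M * energy c w * norm h / energy c v"
      using G'3[OF p, of w h] by (intro divide_right_mono) (simp_all add: G' less_imp_le)
    also have "\<dots> = energy c w / energy c v * (M * norm h)" by simp
    also have "\<dots> \<le> M * (M * norm h)"
      using v e(3) by (intro mult_right_mono) (auto simp: divide_le_eq)
    finally have \<pi>: "norm \<pi> / energy c v \<le> M\<^sup>2 * norm h" by (simp add: power2_eq_square)
    have "\<bar>D_phase f (t, x, v) (a, b, \<pi>)\<bar> \<le> C / energy c v ^ 3 * (\<bar>a\<bar> + norm b + norm \<pi> / energy c v)"
      using inK[OF p, of w] by (intro C(3)) (simp add: G)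
    also have "\<dots> \<le> C * M ^ 3 / energy c w ^ 3 * (M * norm h + M * norm h + M\<^sup>2 * norm h)"
      using G'1[OF p, of w h] G'2[OF p, of w h] \<pi> pow[OF p, of w] C(1) e(3)
      by (intro mult_mono add_mono) (auto simp: G G' less_imp_le)
    also have "\<dots> = C * M ^ 3 * (2 * M + M\<^sup>2) / energy c w ^ 3 * norm h"
      by (simp add: algebra_simps add_divide_distrib)
    also have "\<dots> \<le> L / energy c w ^ 3 * norm h"
      using CL(2) by (intro mult_right_mono divide_right_mono) (auto simp: less_imp_le)
    finally show ?thesis by (simp add: G G')
  qed
  show thesis
  proof (rule that[OF L0])
    fix p assume p: "p \<in> ball p0 e"
    show "(\<lambda>w. f (G p w)) \<in> borel_measurable borel"
      by (intro borel_measurable_continuous_onI continuous_on_compose2[OF smooth_continuous[OF sm] cont[OF p]]) auto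
    have "\<bar>f (G p w)\<bar> \<le> L / energy c w ^ 3" for w
    proof -
      obtain t x v where G: "G p w = (t, x, v)" by (metis surj_pair)
      have "\<bar>f (G p w)\<bar> \<le> C / energy c v ^ 3"
        unfolding G using inK[OF p, of w] by (intro C(2)) (simp add: G)
      also have "\<dots> \<le> C * M ^ 3 / energy c w ^ 3" using pow[OF p, of w] by (simp add: G)
      also have "\<dots> \<le> L / energy c w ^ 3" using CL(1) by (intro divide_right_mono) (auto simp: less_imp_le)
      finally show ?thesis .
    qed
    then show "cubic_decay L (\<lambda>w. f (G p w))" by (simp add: cubic_decay_def)
    have "norm (f (G p w) - f (G p0 w)) \<le> L / energy c w ^ 3 * norm (p - p0)" for w
    proof (rule differentiable_bound[OF convex_ball[of p0 e] _ _ p])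
      fix q assume q: "q \<in> ball p0 e"
      show "((\<lambda>p. f (G p w)) has_derivative (\<lambda>h. D_phase f (G q w) (G' q w h))) (at q within ball p0 e)"
        by (rule has_derivative_at_withinI[OF derf[OF q]])
      show "onorm (\<lambda>h. D_phase f (G q w) (G' q w h)) \<le> L / energy c w ^ 3"
        using bound[OF q] L0 by (intro onorm_bound) (auto simp: less_imp_le)
    qed (use e in simp)
    then show "cubic_decay (L * norm (p - p0)) (\<lambda>w. f (G p w) - f (G p0 w))" by (simp add: cubic_decay_def)
  qed (rule derf, use e in simp)
qed

lemma Q_transport_has_derivative:
  assumes fam: "transport_family p0 e K M G G'" and adm: "admissible c f" "admissible c h"
  shows "((\<lambda>p. Q (\<lambda>w. f (G p w)) (\<lambda>w. h (G p w)) v) has_derivative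
    (\<lambda>\<pi>. Q (\<lambda>w. D_phase f (G p0 w) (G' p0 w \<pi>)) (\<lambda>w. h (G p0 w)) v
        + Q (\<lambda>w. f (G p0 w)) (\<lambda>w. D_phase h (G p0 w) (G' p0 w \<pi>)) v)) (at p0)"
proof -
  have e: "e > 0" using fam by (simp add: transport_family_def)
  obtain L1 where L1: "0 \<le> L1"
    "\<And>p. p \<in> ball p0 e \<Longrightarrow> (\<lambda>w. f (G p w)) \<in> borel_measurable borel"
    "\<And>p. p \<in> ball p0 e \<Longrightarrow> cubic_decay L1 (\<lambda>w. f (G p w))"
    "\<And>p. p \<in> ball p0 e \<Longrightarrow> cubic_decay (L1 * norm (p - p0)) (\<lambda>w. f (G p w) - f (G p0 w))"
    "\<And>w. ((\<lambda>p. f (G p w)) has_derivative (\<lambda>h. D_phase f (G p0 w) (G' p0 w h))) (at p0)"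
    using transported_profile[OF fam adm(1)] by blast
  obtain L2 where L2: "0 \<le> L2"
    "\<And>p. p \<in> ball p0 e \<Longrightarrow> (\<lambda>w. h (G p w)) \<in> borel_measurable borel"
    "\<And>p. p \<in> ball p0 e \<Longrightarrow> cubic_decay L2 (\<lambda>w. h (G p w))"
    "\<And>p. p \<in> ball p0 e \<Longrightarrow> cubic_decay (L2 * norm (p - p0)) (\<lambda>w. h (G p w) - h (G p0 w))"
    "\<And>w. ((\<lambda>p. h (G p w)) has_derivative (\<lambda>k. D_phase h (G p0 w) (G' p0 w k))) (at p0)"
    using transported_profile[OF fam adm(2)] by blast
  have weaken: "cubic_decay K' g" if "cubic_decay K g" "K \<le> K'" for K K' g
    using that unfolding cubic_decay_def
    by (meson divide_right_mono energy_gt_0 less_imp_le order_trans zero_less_power)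
  have le: "L1 * norm (p - p0) \<le> (L1 + L2) * norm (p - p0)" "L2 * norm (p - p0) \<le> (L1 + L2) * norm (p - p0)" for p
    using L1(1) L2(1) by (simp_all add: mult_right_mono)
  show ?thesis
    using L1(1) L2(1)
    by (intro Q_has_derivative[OF e, where K = "L1 + L2" and H = "\<lambda>p w. f (G p w)" and F = "\<lambda>p w. h (G p w)"] L1(2,5) L2(2,5)
        weaken[OF L1(3)] weaken[OF L2(3)] weaken[OF L1(4) le(1)] weaken[OF L2(4) le(2)]) auto
qed


section \<open>Boosts\<close>

text \<open>
  The derivative of \<open>p \<mapsto> vel_map c (boost c p) w\<close>; at \<open>p = 0\<close> it is \<open>(w\<^sub>0 / c) \<pi>\<close>, the velocity part of
  the boost fields.
\<close>
definition boost_derivative :: "real^3 \<Rightarrow> real^3 \<Rightarrow> real^3 \<Rightarrow> real^3" where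
  "boost_derivative p w \<pi> = (energy c w / c + (p \<bullet> w) / (c * (c + energy c p))) *\<^sub>R \<pi>
     + ((\<pi> \<bullet> w) / (c * (c + energy c p)) - (p \<bullet> w) * (p \<bullet> \<pi>) / (energy c p * (c * (c + energy c p)\<^sup>2))) *\<^sub>R p"

lemma boost_has_derivative:
  "((\<lambda>p. vel_map c (boost c p) w) has_derivative boost_derivative p w) (at p)"
proof -
  have nz: "c + energy c p \<noteq> 0" "c \<noteq> 0" "energy c p \<noteq> 0"
    using add_pos_pos[OF c0 energy_gt_0[of p]] c0 energy_gt_0[of p] by (auto simp del: energy_gt_0)
  have "((\<lambda>p. 1 / (c + energy c p)) has_derivative (\<lambda>\<pi>. - (p \<bullet> \<pi>) / (energy c p * (c + energy c p)\<^sup>2))) (at p)"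
    using nz by (auto intro!: derivative_eq_intros energy_has_derivative[OF c0] simp: power2_eq_square field_simps)
  moreover have "((\<lambda>p. w + (energy c w / c + (1 / c) * ((p \<bullet> w) * \<rho> p)) *\<^sub>R p) has_derivative
      (\<lambda>\<pi>. (energy c w / c + (1 / c) * ((p \<bullet> w) * \<rho> p)) *\<^sub>R \<pi>
        + ((1 / c) * ((p \<bullet> w) * \<rho>' \<pi> + (\<pi> \<bullet> w) * \<rho> p)) *\<^sub>R p)) (at p)"
    if "(\<rho> has_derivative \<rho>') (at p)" for \<rho> \<rho>'
    using that nz by (auto intro!: derivative_eq_intros)
  ultimately have "((\<lambda>p. w + (energy c w / c + (1 / c) * ((p \<bullet> w) * (1 / (c + energy c p)))) *\<^sub>R p) has_derivative
      (\<lambda>\<pi>. (energy c w / c + (1 / c) * ((p \<bullet> w) * (1 / (c + energy c p)))) *\<^sub>R \<pi>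
        + ((1 / c) * ((p \<bullet> w) * (- (p \<bullet> \<pi>) / (energy c p * (c + energy c p)\<^sup>2)) + (\<pi> \<bullet> w) * (1 / (c + energy c p)))) *\<^sub>R p)) (at p)"
    by blast
  then show ?thesis
    unfolding vel_map_boost boost_derivative_def[abs_def] using nz
    by (simp add: right_diff_distrib distrib_left ac_simps)
qed

lemma boost_derivative_bound: "norm (boost_derivative p w \<pi>) \<le> 4 * energy c w * norm \<pi>"
proof -
  define P where "P = energy c p"
  define W where "W = energy c w"
  have P: "norm p \<le> P" "1 \<le> P" and W: "norm w \<le> W" "1 \<le> W"
    using norm_less_energy[OF c0, of p] norm_less_energy[OF c0, of w] by (auto simp: P_def W_def energy_ge_1)
  have cP: "norm p \<le> c * (c + P)" "P \<le> c * (c + P)"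
  proof -
    have "1 * (c + P) \<le> c * (c + P)" using c1 P by (intro mult_right_mono) auto
    then have le: "c + P \<le> c * (c + P)" by (simp only: mult_1)
    show "P \<le> c * (c + P)" using le c1 by linarith
    then show "norm p \<le> c * (c + P)" using P(1) by linarith
  qed
  have cP0: "0 < c * (c + P)" using c1 P by simp
  have inn: "\<bar>p \<bullet> w\<bar> \<le> norm p * W" "\<bar>\<pi> \<bullet> w\<bar> \<le> norm \<pi> * W" "\<bar>p \<bullet> \<pi>\<bar> \<le> norm p * norm \<pi>"
    using Cauchy_Schwarz_ineq2[of p w] Cauchy_Schwarz_ineq2[of \<pi> w] Cauchy_Schwarz_ineq2[of p \<pi>]
      mult_left_mono[OF W(1), of "norm p"] mult_left_mono[OF W(1), of "norm \<pi>"] by auto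
  have r: "norm p / (c * (c + P)) \<le> 1" using cP cP0 by (simp add: divide_le_eq_1)
  have 1: "\<bar>W / c + (p \<bullet> w) / (c * (c + P))\<bar> \<le> 2 * W"
  proof -
    have "\<bar>(p \<bullet> w) / (c * (c + P))\<bar> \<le> norm p * W / (c * (c + P))"
      unfolding abs_divide using inn(1) cP0 by (intro frac_le) auto
    also have "\<dots> = norm p / (c * (c + P)) * W" by simp
    also have "\<dots> \<le> 1 * W" using r W by (intro mult_right_mono) auto
    finally have "\<bar>(p \<bullet> w) / (c * (c + P))\<bar> \<le> W" by simp
    moreover have "\<bar>W / c\<bar> \<le> W" using c1 W by (simp add: divide_le_eq mult_le_cancel_left1)
    ultimately show ?thesis by linarith
  qed
  have 2: "\<bar>(\<pi> \<bullet> w) / (c * (c + P))\<bar> * norm p \<le> W * norm \<pi>"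
  proof -
    have "\<bar>(\<pi> \<bullet> w) / (c * (c + P))\<bar> * norm p = \<bar>\<pi> \<bullet> w\<bar> * (norm p / (c * (c + P)))"
      using cP0 by (simp add: abs_divide)
    also have "\<dots> \<le> norm \<pi> * W * 1" using inn(2) r W cP0 by (intro mult_mono) auto
    finally show ?thesis by (simp add: mult.commute)
  qed
  have 3: "\<bar>(p \<bullet> w) * (p \<bullet> \<pi>) / (P * (c * (c + P)\<^sup>2))\<bar> * norm p \<le> W * norm \<pi>"
  proof -
    have p2: "norm p / P \<le> 1" "norm p / (c + P) \<le> 1" using P c1 by (simp_all add: divide_le_eq_1)
    have "\<bar>(p \<bullet> w) * (p \<bullet> \<pi>) / (P * (c * (c + P)\<^sup>2))\<bar> * norm p
        = \<bar>p \<bullet> w\<bar> * \<bar>p \<bullet> \<pi>\<bar> / (P * (c * (c + P)\<^sup>2)) * norm p"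
      using P c1 by (simp add: abs_mult abs_divide)
    also have "\<dots> \<le> (norm p * W) * (norm p * norm \<pi>) / (P * (c * (c + P)\<^sup>2)) * norm p"
      using inn P W c1 by (intro mult_right_mono divide_right_mono mult_mono) auto
    also have "\<dots> = (W * norm \<pi>) * ((norm p / P) * (norm p / (c * (c + P))) * (norm p / (c + P)))"
      by (simp add: power2_eq_square mult_ac)
    also have "\<dots> \<le> (W * norm \<pi>) * (1 * 1 * 1)"
      using p2 r P W c1 by (intro mult_left_mono mult_mono) auto
    finally show ?thesis by simp
  qed
  have "norm (boost_derivative p w \<pi>) \<le> \<bar>W / c + (p \<bullet> w) / (c * (c + P))\<bar> * norm \<pi>
     + \<bar>(\<pi> \<bullet> w) / (c * (c + P)) - (p \<bullet> w) * (p \<bullet> \<pi>) / (P * (c * (c + P)\<^sup>2))\<bar> * norm p"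
    unfolding boost_derivative_def P_def[symmetric] W_def[symmetric] by (rule order_trans[OF norm_triangle_ineq]) simp
  also have "\<dots> \<le> 2 * W * norm \<pi> + (W * norm \<pi> + W * norm \<pi>)"
  proof (rule add_mono)
    show "\<bar>W / c + (p \<bullet> w) / (c * (c + P))\<bar> * norm \<pi> \<le> 2 * W * norm \<pi>" using 1 by (intro mult_right_mono) auto
    show "\<bar>(\<pi> \<bullet> w) / (c * (c + P)) - (p \<bullet> w) * (p \<bullet> \<pi>) / (P * (c * (c + P)\<^sup>2))\<bar> * norm p \<le> W * norm \<pi> + W * norm \<pi>"
      by (rule order_trans[OF mult_right_mono[OF abs_triangle_ineq4 norm_ge_zero]])
         (unfold distrib_right, rule add_mono[OF 2 3])
  qed
  finally show ?thesis by (simp add: W_def mult_ac)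
qed

text \<open>
  The boosted energy is \<open>(p\<^sub>0 w\<^sub>0 + p \<bullet> w) / c \<ge> (p\<^sub>0 - |p|) w\<^sub>0 / c\<close>, and \<open>p\<^sub>0 - |p| = c\<^sup>2 / (p\<^sub>0 + |p|)\<close>.
\<close>
lemma energy_le_boost: "energy c w \<le> 2 * energy c p * energy c (vel_map c (boost c p) w)"
proof -
  define P where "P = energy c p"
  define W where "W = energy c w"
  have P: "norm p < P" "1 \<le> P" and W: "norm w < W" "1 \<le> W"
    using norm_less_energy[OF c0, of p] norm_less_energy[OF c0, of w] by (auto simp: P_def W_def energy_ge_1)
  have "(P - norm p) * (P + norm p) = c\<^sup>2"
    using energy_sq[of c p] by (simp add: P_def power2_norm_eq_inner[symmetric] power2_eq_square algebra_simps)
  also have "c\<^sup>2 \<ge> c" using c1 by (simp add: power2_eq_square mult_le_cancel_left1)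
  finally have "c \<le> (P - norm p) * (P + norm p)" .
  also have "\<dots> \<le> (P - norm p) * (2 * P)" using P by (intro mult_left_mono) auto
  finally have "W * c \<le> W * ((P - norm p) * (2 * P))" using W by (intro mult_left_mono) auto
  also have "\<dots> = 2 * P * (P * W - norm p * W)" by (simp add: algebra_simps)
  also have "\<dots> \<le> 2 * P * (P * W + p \<bullet> w)"
  proof -
    have "\<bar>p \<bullet> w\<bar> \<le> norm p * W"
      using Cauchy_Schwarz_ineq2[of p w] mult_left_mono[of "norm w" W "norm p"] W by simp
    then show ?thesis using P by (intro mult_left_mono) auto
  qed
  finally have "W * c \<le> 2 * P * (P * W + p \<bullet> w)" .
  then show ?thesis unfolding energy_vel_map_boost[OF c0] P_def[symmetric] W_def[symmetric]
    using c0 by (simp add: pos_le_divide_eq)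
qed

text \<open>
  The velocity slot of the parameter \<open>z\<close> is used as the label of a boost. At \<open>w = 0\<close> the family gives
  \<open>z\<close> itself; at \<open>z = (t, x, 0)\<close> it gives \<open>(t, x, w)\<close>.
\<close>
definition boost_family :: "phase \<Rightarrow> real^3 \<Rightarrow> phase" where
  "boost_family z w = (fst z, fst (snd z), vel_map c (boost c (snd (snd z))) w)"

definition boost_family' :: "phase \<Rightarrow> real^3 \<Rightarrow> phase \<Rightarrow> phase" where
  "boost_family' z w h = (fst h, fst (snd h), boost_derivative (snd (snd z)) w (snd (snd h)))"

lemma transport_boost_family: "\<exists>K M. transport_family z0 1 K M boost_family boost_family'"
proof -
  obtain t x p1 where z0: "z0 = (t, x, p1)" by (metis surj_pair)
  define E where "E = c + norm p1 + 1"
  have near: "fst z \<in> cball t 1" "fst (snd z) \<in> cball x 1" "norm (snd (snd z)) \<le> norm p1 + 1" if "z \<in> ball z0 1" for z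
  proof -
    have d: "dist z0 z \<le> 1" using that by simp
    have 1: "dist (fst z0) (fst z) \<le> dist z0 z" "dist (snd z0) (snd z) \<le> dist z0 z"
      "dist (fst (snd z0)) (fst (snd z)) \<le> dist (snd z0) (snd z)"
      "dist (snd (snd z0)) (snd (snd z)) \<le> dist (snd z0) (snd z)"
      by (rule dist_fst_le dist_snd_le)+
    show "fst z \<in> cball t 1" "fst (snd z) \<in> cball x 1" using 1 d by (auto simp: z0)
    have "dist p1 (snd (snd z)) \<le> 1" using 1 d by (simp add: z0)
    then show "norm (snd (snd z)) \<le> norm p1 + 1"
      using norm_triangle_ineq2[of "snd (snd z)" p1] by (simp add: dist_norm norm_minus_commute)
  qed
  have E: "energy c p \<le> E" if "norm p \<le> norm p1 + 1" for p
  proof -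
    have "(energy c p)\<^sup>2 \<le> (c + norm p)\<^sup>2"
      using c0 by (simp add: energy_sq power2_sum power2_norm_eq_inner)
    then have "energy c p \<le> c + norm p" by (rule power2_le_imp_le) (use c0 in simp)
    then show ?thesis using that by (simp add: E_def)
  qed
  \<comment> \<open>the 4 is the constant in the bound of the boost derivative; E bounds the energies of the labels\<close>
  have "transport_family z0 1 (cball t 1 \<times> cball x 1) (4 * E) boost_family boost_family'"
    unfolding transport_family_def
  proof (intro conjI ballI allI)
    show "compact (cball t 1 \<times> cball x 1)" by (intro compact_Times compact_cball)
    have E1: "1 \<le> E" using c1 norm_ge_zero[of p1] by (simp add: E_def del: norm_ge_zero)
    then show "1 \<le> 4 * E" by simp
    fix z assume z: "z \<in> ball z0 1"
    have "c + energy c (snd (snd z)) \<noteq> 0"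
      using add_pos_pos[OF c0 energy_gt_0[of "snd (snd z)"]] by (auto simp del: energy_gt_0)
    then show "continuous_on UNIV (boost_family z)"
      unfolding boost_family_def[abs_def] vel_map_boost using c0 by (intro continuous_intros) auto
    fix w
    show "(fst (boost_family z w), fst (snd (boost_family z w))) \<in> cball t 1 \<times> cball x 1"
      using near[OF z] by (simp add: boost_family_def)
    have "energy c w \<le> 2 * energy c (snd (snd z)) * energy c (vel_map c (boost c (snd (snd z))) w)"
      by (rule energy_le_boost)
    also have "\<dots> \<le> 4 * E * energy c (vel_map c (boost c (snd (snd z))) w)"
      using E[OF near(3)[OF z]] E1 by (intro mult_right_mono) (auto simp: less_imp_le)
    finally show "energy c w \<le> 4 * E * energy c (snd (snd (boost_family z w)))" by (simp add: boost_family_def)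
    have s: "((\<lambda>z::phase. snd (snd z)) has_derivative (\<lambda>h. snd (snd h))) (at z)"
      by (auto intro!: derivative_eq_intros)
    show "((\<lambda>z. boost_family z w) has_derivative boost_family' z w) (at z)"
      unfolding boost_family_def boost_family'_def[abs_def]
      by (intro has_derivative_Pair has_derivative_compose[OF s boost_has_derivative])
         (auto intro!: derivative_eq_intros)
    fix h :: phase
    have n: "norm (fst h) \<le> norm h" "norm (snd h) \<le> norm h" "norm (fst (snd h)) \<le> norm (snd h)" "norm (snd (snd h)) \<le> norm (snd h)"
      using norm_fst_le[of "fst h" "snd h"] norm_snd_le[of "snd h" "fst h"]
        norm_fst_le[of "fst (snd h)" "snd (snd h)"] norm_snd_le[of "snd (snd h)" "fst (snd h)"] by simp_all
    have 1: "1 * norm h \<le> 4 * E * norm h" using E1 by (intro mult_right_mono) auto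
    show "\<bar>fst (boost_family' z w h)\<bar> \<le> 4 * E * norm h" "norm (fst (snd (boost_family' z w h))) \<le> 4 * E * norm h"
      using n 1 by (simp_all add: boost_family'_def)
    have "norm (snd (snd (boost_family' z w h))) \<le> 4 * energy c w * norm (snd (snd h))"
      by (simp add: boost_family'_def boost_derivative_bound)
    also have "\<dots> \<le> 4 * energy c w * norm h" using n by (intro mult_left_mono) (auto simp: less_imp_le)
    also have "\<dots> \<le> 4 * E * energy c w * norm h"
      using E1 by (intro mult_right_mono) (auto simp: less_imp_le)
    finally show "norm (snd (snd (boost_family' z w h))) \<le> 4 * E * energy c w * norm h" .
  qed simp
  then show ?thesis by blast
qed

lemma boost_family_rest [simp]: "boost_family (t, x, 0) w = (t, x, w)"
  and boost_family_0 [simp]: "boost_family z 0 = z"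
  and boost_family'_rest [simp]: "boost_family' (t, x, 0) w (a, b, \<pi>) = (a, b, (energy c w / c) *\<^sub>R \<pi>)"
  using c0 by (simp_all add: boost_family_def vel_map_boost boost_family'_def boost_derivative_def)

abbreviation Q_phase where "Q_phase \<equiv> Q_op c \<gamma> \<sigma>0"

lemma Q_phase_eq: "Q_phase f h (t, x, v) = Q (\<lambda>w. f (t, x, w)) (\<lambda>w. h (t, x, w)) v"
  by (simp add: Q_op_def)

lemma slice_measurable:
  fixes f :: "phase \<Rightarrow> real"
  assumes "smooth f" shows "(\<lambda>w. f (t, x, w)) \<in> borel_measurable borel"
proof (rule borel_measurable_continuous_onI)
  have "continuous_on UNIV (\<lambda>w::real^3. (t, x, w))" by (intro continuous_intros)
  from continuous_on_compose2[OF smooth_continuous[OF assms] this]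
  show "continuous_on UNIV (\<lambda>w. f (t, x, w))" by simp
qed

lemma Q_phase_boost:
  assumes "smooth f" "smooth h"
  shows "energy c (snd (snd (boost_family z v))) * Q_phase f h (boost_family z v) =
    energy c v * Q (\<lambda>w. f (boost_family z w)) (\<lambda>w. h (boost_family z w)) v"
  unfolding boost_family_def Q_phase_eq fst_conv snd_conv
  by (rule Q_covariant lorentz_boost boost_preserves_invariant_measure slice_measurable c0 assms)+

text \<open>
  Covariance evaluated at \<open>w = 0\<close>, that is with the output velocity at rest, trades the dependence of
  the singular kernel on \<open>v\<close> for a smooth dependence of the two arguments on all of \<open>(t, x, v)\<close>.
\<close>
lemma Q_phase_differentiable:
  assumes "admissible c f" "admissible c h"
  shows "Q_phase f h differentiable (at z)"
proof -
  have sm: "smooth f" "smooth h" using assms by (auto simp: admissible_def)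
  obtain K M where fam: "transport_family z 1 K M boost_family boost_family'"
    using transport_boost_family by blast
  have "Q_phase f h = (\<lambda>z. c * Q (\<lambda>w. f (boost_family z w)) (\<lambda>w. h (boost_family z w)) 0 / energy c (snd (snd z)))"
  proof
    fix z
    show "Q_phase f h z = c * Q (\<lambda>w. f (boost_family z w)) (\<lambda>w. h (boost_family z w)) 0 / energy c (snd (snd z))"
      using Q_phase_boost[OF sm, of z 0] less_imp_neq[OF energy_gt_0, of "snd (snd z)"] c0
      by (simp add: field_simps)
  qed
  moreover have "(\<lambda>z. Q (\<lambda>w. f (boost_family z w)) (\<lambda>w. h (boost_family z w)) 0) differentiable (at z)"
    using Q_transport_has_derivative[OF fam assms] by (auto simp: differentiable_def)
  moreover have "(\<lambda>z::phase. energy c (snd (snd z))) differentiable (at z)"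
  proof -
    have s: "((\<lambda>z::phase. snd (snd z)) has_derivative (\<lambda>h. snd (snd h))) (at z)"
      by (auto intro!: derivative_eq_intros)
    show ?thesis using has_derivative_compose[OF s energy_has_derivative[OF c0]] by (auto simp: differentiable_def)
  qed
  ultimately show ?thesis
    using less_imp_neq[OF energy_gt_0, of "snd (snd z)"] by (auto intro!: differentiable_divide differentiable_mult)
qed

text \<open>
  Differentiating the covariance identity at the trivial boost. The last term is the derivative of the
  energy factor in front of the collision integral. The directions \<open>(a, b, (v\<^sub>0 / c) \<pi>)\<close> with \<open>a\<close>, \<open>b\<close>,
  \<open>\<pi>\<close> fixed include the translations, the scaling field at a given point, and the boost fields.
\<close>
lemma Q_phase_boost_identity:
  assumes adm: "admissible c f" "admissible c h"
  shows "D_phase (Q_phase f h) (t, x, v) (a, b, (energy c v / c) *\<^sub>R \<pi>) =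
    Q (\<lambda>w. D_phase f (t, x, w) (a, b, (energy c w / c) *\<^sub>R \<pi>)) (\<lambda>w. h (t, x, w)) v
    + Q (\<lambda>w. f (t, x, w)) (\<lambda>w. D_phase h (t, x, w) (a, b, (energy c w / c) *\<^sub>R \<pi>)) v
    - (v \<bullet> \<pi>) / (c * energy c v) * Q_phase f h (t, x, v)"
proof -
  have sm: "smooth f" "smooth h" using adm by (auto simp: admissible_def)
  define z where "z = (t, x, 0 :: real^3)"
  obtain K M where fam: "transport_family z 1 K M boost_family boost_family'"
    using transport_boost_family by blast
  have G: "((\<lambda>z. boost_family z v) has_derivative boost_family' z v) (at z)"
    using fam by (simp add: transport_family_def)
  have Gz: "boost_family z v = (t, x, v)" by (simp add: z_def)
  have DQ: "(Q_phase f h has_derivative D_phase (Q_phase f h) (t, x, v)) (at (boost_family z v))"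
    using Q_phase_differentiable[OF adm] by (simp add: Gz frechet_derivative_works)
  have s: "((\<lambda>z. snd (snd (boost_family z v))) has_derivative (\<lambda>h. snd (snd (boost_family' z v h)))) (at z)"
    by (intro has_derivative_snd G)
  have "((\<lambda>z. energy c (snd (snd (boost_family z v)))) has_derivative
      (\<lambda>h. v \<bullet> snd (snd (boost_family' z v h)) / energy c v)) (at z)"
    using has_derivative_compose[OF s energy_has_derivative[OF c0]] by (simp add: Gz)
  \<comment> \<open>the two sides of the covariance identity are differentiated separately and compared\<close>
  from has_derivative_mult[OF this has_derivative_compose[OF G DQ]]
  have 1: "((\<lambda>z. energy c (snd (snd (boost_family z v))) * Q_phase f h (boost_family z v)) has_derivative
      (\<lambda>k. energy c v * D_phase (Q_phase f h) (t, x, v) (boost_family' z v k)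
         + v \<bullet> snd (snd (boost_family' z v k)) / energy c v * Q_phase f h (t, x, v))) (at z)"
    by (simp add: Gz)
  have 2: "((\<lambda>z. energy c v * Q (\<lambda>w. f (boost_family z w)) (\<lambda>w. h (boost_family z w)) v) has_derivative
      (\<lambda>k. energy c v * (Q (\<lambda>w. D_phase f (boost_family z w) (boost_family' z w k)) (\<lambda>w. h (boost_family z w)) v
        + Q (\<lambda>w. f (boost_family z w)) (\<lambda>w. D_phase h (boost_family z w) (boost_family' z w k)) v))) (at z)"
    by (rule has_derivative_mult_right[OF Q_transport_has_derivative[OF fam adm]])
  have "energy c v * D_phase (Q_phase f h) (t, x, v) (boost_family' z v (a, b, \<pi>))
         + v \<bullet> snd (snd (boost_family' z v (a, b, \<pi>))) / energy c v * Q_phase f h (t, x, v)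
      = energy c v * (Q (\<lambda>w. D_phase f (boost_family z w) (boost_family' z w (a, b, \<pi>))) (\<lambda>w. h (boost_family z w)) v
        + Q (\<lambda>w. f (boost_family z w)) (\<lambda>w. D_phase h (boost_family z w) (boost_family' z w (a, b, \<pi>))) v)"
    using fun_cong[OF has_derivative_unique[OF 1[unfolded Q_phase_boost[OF sm]] 2], of "(a, b, \<pi>)"] .
  then have "energy c v * D_phase (Q_phase f h) (t, x, v) (a, b, (energy c v / c) *\<^sub>R \<pi>)
      + (v \<bullet> \<pi>) / c * Q_phase f h (t, x, v)
      = energy c v * (Q (\<lambda>w. D_phase f (t, x, w) (a, b, (energy c w / c) *\<^sub>R \<pi>)) (\<lambda>w. h (t, x, w)) v
        + Q (\<lambda>w. f (t, x, w)) (\<lambda>w. D_phase h (t, x, w) (a, b, (energy c w / c) *\<^sub>R \<pi>)) v)"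
    using less_imp_neq[OF energy_gt_0, of v] by (simp add: z_def)
  then show ?thesis
    using less_imp_neq[OF energy_gt_0, of v] c0 by (simp add: field_simps)
qed

section \<open>Rotations\<close>

definition plane_part :: "3 \<Rightarrow> 3 \<Rightarrow> real^3 \<Rightarrow> real^3" where
  "plane_part i j w = (w $ i) *\<^sub>R axis i 1 + (w $ j) *\<^sub>R axis j 1"

definition quarter_turn :: "3 \<Rightarrow> 3 \<Rightarrow> real^3 \<Rightarrow> real^3" where
  "quarter_turn i j w = (w $ i) *\<^sub>R axis j 1 - (w $ j) *\<^sub>R axis i 1"

text \<open>
  The rotation by the angle \<open>s\<close> in the plane of the axes \<open>i\<close> and \<open>j\<close>, written without a case
  distinction on the components.
\<close>
definition rotation :: "3 \<Rightarrow> 3 \<Rightarrow> real \<Rightarrow> real^3 \<Rightarrow> real^3" where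
  "rotation i j s w = w + (cos s - 1) *\<^sub>R plane_part i j w + sin s *\<^sub>R quarter_turn i j w"

definition rotation' :: "3 \<Rightarrow> 3 \<Rightarrow> real \<Rightarrow> real^3 \<Rightarrow> real^3" where
  "rotation' i j s w = cos s *\<^sub>R quarter_turn i j w - sin s *\<^sub>R plane_part i j w"

lemma orthogonal_rotation:
  assumes "i \<noteq> j"
  shows "orthogonal_transformation (rotation i j s)"
  unfolding orthogonal_transformation
proof (intro conjI allI)
  show "linear (rotation i j s)"
    by (rule linearI) (simp_all add: rotation_def plane_part_def quarter_turn_def algebra_simps)
  fix w :: "real^3"
  define A where "A = (w $ i)\<^sup>2 + (w $ j)\<^sup>2"
  let ?P = "plane_part i j w" and ?J = "quarter_turn i j w"
  have n: "(axis i 1 :: real^3) $ j = 0" "(axis j 1 :: real^3) $ i = 0"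
    using assms by (auto simp: axis_def)
  have ax: "axis i 1 \<bullet> (axis j 1 :: real^3) = 0" "axis j 1 \<bullet> (axis i 1 :: real^3) = 0"
    "axis k 1 \<bullet> (axis k 1 :: real^3) = 1" "w \<bullet> axis k 1 = w $ k" "axis k 1 \<bullet> w = w $ k" for k
    by (simp_all add: inner_axis inner_axis' n)
  have i: "w \<bullet> ?P = A" "?P \<bullet> w = A" "?P \<bullet> ?P = A" "?J \<bullet> ?J = A" "w \<bullet> ?J = 0" "?J \<bullet> w = 0" "?P \<bullet> ?J = 0" "?J \<bullet> ?P = 0"
    by (simp_all add: plane_part_def quarter_turn_def inner_simps ax A_def power2_eq_square)
  define k where "k = cos s - 1"
  have "rotation i j s w \<bullet> rotation i j s w = w \<bullet> w + (2 * k + k\<^sup>2 + (sin s)\<^sup>2) * A"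
    by (simp add: rotation_def inner_simps i power2_eq_square flip: k_def) (simp add: algebra_simps)
  also have "2 * k + k\<^sup>2 + (sin s)\<^sup>2 = 0"
    using sin_cos_squared_add[of s] by (simp add: k_def power2_eq_square algebra_simps)
  finally show "norm (rotation i j s w) = norm w" by (simp add: norm_eq)
qed

lemma rotation_has_derivative:
  "((\<lambda>s. rotation i j s w) has_derivative (\<lambda>\<sigma>. \<sigma> *\<^sub>R rotation' i j s w)) (at s)"
  unfolding rotation_def rotation'_def
  by (auto intro!: derivative_eq_intros simp: algebra_simps)

lemma rotation'_bound: "norm (rotation' i j s w) \<le> 4 * norm w"
proof -
  have "norm (plane_part i j w) \<le> \<bar>w $ i\<bar> + \<bar>w $ j\<bar>" "norm (quarter_turn i j w) \<le> \<bar>w $ i\<bar> + \<bar>w $ j\<bar>"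
    unfolding plane_part_def quarter_turn_def
    by (rule order_trans[OF norm_triangle_ineq], simp add: norm_axis_1)
       (rule order_trans[OF norm_triangle_ineq4], simp add: norm_axis_1)
  then have pq: "norm (plane_part i j w) \<le> 2 * norm w" "norm (quarter_turn i j w) \<le> 2 * norm w"
    using component_le_norm_cart[of w i] component_le_norm_cart[of w j] by linarith+
  have "norm (rotation' i j s w) \<le> \<bar>cos s\<bar> * norm (quarter_turn i j w) + \<bar>sin s\<bar> * norm (plane_part i j w)"
    unfolding rotation'_def by (rule order_trans[OF norm_triangle_ineq4]) simp
  also have "\<dots> \<le> 1 * (2 * norm w) + 1 * (2 * norm w)"
    using pq by (intro add_mono mult_mono) auto
  finally show ?thesis by simp
qed

text \<open>
  Rotations are not among the directions of the previous identity, since the velocity part of their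
  field is not \<open>v\<^sub>0 / c\<close> times a constant vector. They are treated in the same way with the angle as the only
  parameter; no correction term arises because rotations preserve energy.
\<close>
lemma Q_phase_rotation_identity:
  assumes ij: "i \<noteq> j" and adm: "admissible c f" "admissible c h"
  shows "D_phase (Q_phase f h) (t, x, v) (0, quarter_turn i j x, quarter_turn i j v) =
    Q (\<lambda>w. D_phase f (t, x, w) (0, quarter_turn i j x, quarter_turn i j w)) (\<lambda>w. h (t, x, w)) v
    + Q (\<lambda>w. f (t, x, w)) (\<lambda>w. D_phase h (t, x, w) (0, quarter_turn i j x, quarter_turn i j w)) v"
proof -
  have sm: "smooth f" "smooth h" using adm by (auto simp: admissible_def)
  let ?R = "rotation i j" and ?R' = "rotation' i j"
  note orth = orthogonal_rotation[OF ij]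
  define G where "G s w = (t, ?R s x, ?R s w)" for s w
  define G' where "G' s w \<sigma> = (0::real, \<sigma> *\<^sub>R ?R' s x, \<sigma> *\<^sub>R ?R' s w)" for s w \<sigma>
  have G_der: "((\<lambda>s. G s w) has_derivative G' s w) (at s)" for s w
    unfolding G_def G'_def[abs_def] by (intro has_derivative_Pair has_derivative_const rotation_has_derivative)
  have nR: "norm (?R s w) = norm w" for s w by (rule orthogonal_transformation_norm[OF orth])
  \<comment> \<open>rotations preserve norms, so the point in space stays in the ball of its initial radius\<close>
  have fam: "transport_family 0 1 ({t} \<times> cball (0 :: real^3) (norm x)) (4 * (1 + norm x)) G G'"
    unfolding transport_family_def
  proof (intro conjI ballI allI)
    show "compact ({t} \<times> cball (0 :: real^3) (norm x))" by (intro compact_Times) auto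
    fix s w
    show "continuous_on UNIV (G s)"
      unfolding G_def[abs_def] by (intro continuous_intros linear_continuous_on)
        (simp add: linear_linear orthogonal_transformation_linear[OF orth])
    show "(fst (G s w), fst (snd (G s w))) \<in> {t} \<times> cball (0 :: real^3) (norm x)" by (simp add: G_def nR)
    have "1 * energy c w \<le> 4 * (1 + norm x) * energy c w" by (intro mult_right_mono) (auto simp: less_imp_le)
    then show "energy c w \<le> 4 * (1 + norm x) * energy c (snd (snd (G s w)))"
      by (simp add: G_def energy_orthogonal[OF orth])
    fix \<sigma>
    show "\<bar>fst (G' s w \<sigma>)\<bar> \<le> 4 * (1 + norm x) * norm \<sigma>" by (simp add: G'_def)
    have "\<bar>\<sigma>\<bar> * norm (?R' s x) \<le> \<bar>\<sigma>\<bar> * (4 * norm x)" by (intro mult_left_mono rotation'_bound) auto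
    also have "\<dots> \<le> \<bar>\<sigma>\<bar> * (4 * (1 + norm x))" by (intro mult_left_mono) auto
    finally show "norm (fst (snd (G' s w \<sigma>))) \<le> 4 * (1 + norm x) * norm \<sigma>" by (simp add: G'_def mult.commute)
    have "\<bar>\<sigma>\<bar> * norm (?R' s w) \<le> \<bar>\<sigma>\<bar> * (4 * norm w)" by (intro mult_left_mono rotation'_bound) auto
    also have "\<dots> \<le> \<bar>\<sigma>\<bar> * (4 * (1 + norm x) * energy c w)"
      using norm_less_energy[OF c0, of w] by (intro mult_left_mono mult_mono) auto
    finally show "norm (snd (snd (G' s w \<sigma>))) \<le> 4 * (1 + norm x) * energy c w * norm \<sigma>" by (simp add: G'_def mult.commute)
  qed (use G_der in auto)
  have G0: "G 0 w = (t, x, w)" and G'0: "G' 0 w 1 = (0, quarter_turn i j x, quarter_turn i j w)" for w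
    by (simp_all add: G_def G'_def rotation_def rotation'_def)
  \<comment> \<open>covariance under a rotation of the velocities only; the rotation of space is carried by the parameter\<close>
  have cov: "Q_phase f h (G s v) = Q (\<lambda>w. f (G s w)) (\<lambda>w. h (G s w)) v" for s
  proof -
    have "energy c (vel_map c (spatial (?R s)) v) * Q (\<lambda>w. f (t, ?R s x, w)) (\<lambda>w. h (t, ?R s x, w)) (vel_map c (spatial (?R s)) v) =
      energy c v * Q (\<lambda>w. f (t, ?R s x, vel_map c (spatial (?R s)) w)) (\<lambda>w. h (t, ?R s x, vel_map c (spatial (?R s)) w)) v"
      by (rule Q_covariant[OF lorentz_spatial[OF orth c0]])
         (simp_all add: orthogonal_preserves_invariant_measure[OF orth c0] slice_measurable sm)
    then show ?thesis
      using less_imp_neq[OF energy_gt_0, of v] by (simp add: G_def Q_phase_eq energy_orthogonal[OF orth])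
  qed
  have DQ: "(Q_phase f h has_derivative D_phase (Q_phase f h) (t, x, v)) (at (G 0 v))"
    using Q_phase_differentiable[OF adm] by (simp add: G0 frechet_derivative_works)
  have "(\<lambda>\<sigma>. D_phase (Q_phase f h) (t, x, v) (G' 0 v \<sigma>)) =
    (\<lambda>\<sigma>. Q (\<lambda>w. D_phase f (G 0 w) (G' 0 w \<sigma>)) (\<lambda>w. h (G 0 w)) v
        + Q (\<lambda>w. f (G 0 w)) (\<lambda>w. D_phase h (G 0 w) (G' 0 w \<sigma>)) v)"
    using has_derivative_unique[OF has_derivative_compose[OF G_der DQ, unfolded cov] Q_transport_has_derivative[OF fam adm]] .
  from fun_cong[OF this, of 1] show ?thesis by (simp only: G0 G'0)
qed

section \<open>The vector fields as directional derivatives\<close>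

lemma Omega_boost_eq:
  assumes "f differentiable (at (t, x, v))"
  shows "Omega_boost c i f (t, x, v) = D_phase f (t, x, v) (x $ i / c\<^sup>2, t *\<^sub>R axis i 1, (energy c v / c) *\<^sub>R axis i 1)"
  unfolding D_phase_expansion[OF assms]
  by (simp add: Omega_boost_def axis_def if_distrib[where f = "\<lambda>x. _ * x"] if_distrib[where f = "\<lambda>x. x * _"] cong: if_cong)

lemma S_field_eq:
  assumes "f differentiable (at (t, x, v))"
  shows "S_field c f (t, x, v) = D_phase f (t, x, v) (t / c, (1 / c) *\<^sub>R x, 0)"
  unfolding D_phase_expansion[OF assms]
  by (simp add: S_field_def distrib_left sum_distrib_left sum_divide_distrib add_divide_distrib)

lemma Omega_rot_eq:
  assumes "f differentiable (at (t, x, v))"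
  shows "Omega_rot i j f (t, x, v) = D_phase f (t, x, v) (0, quarter_turn i j x, quarter_turn i j v)"
  unfolding D_phase_expansion[OF assms]
  by (simp add: Omega_rot_def quarter_turn_def axis_def left_diff_distrib sum_subtractf
      if_distrib[where f = "\<lambda>x. _ * x"] if_distrib[where f = "\<lambda>x. x * _"] cong: if_cong)

end

theorem corollary5p16:
  fixes c \<gamma> :: real and \<sigma>0 :: "real \<Rightarrow> real" and f h :: "phase \<Rightarrow> real"
  assumes "c \<ge> 1"
    and "-2 < \<gamma>" and "\<gamma> \<le> 0"
    and "set_borel_measurable borel {0..pi} \<sigma>0"
    and "\<exists>C. \<forall>\<theta>\<in>{0..pi}. 0 \<le> \<sigma>0 \<theta> \<and> \<sigma>0 \<theta> \<le> C"
    and "admissible c f" and "admissible c h"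
  shows "Q_op c \<gamma> \<sigma>0 f h differentiable_on UNIV \<and>
    (\<forall>Z \<in> {d_t} \<union> {d_x i | i. True} \<union> {Omega_rot i j | i j. i \<noteq> j} \<union> {S_field c}. \<forall>z.
       Z (Q_op c \<gamma> \<sigma>0 f h) z = Q_op c \<gamma> \<sigma>0 (Z f) h z + Q_op c \<gamma> \<sigma>0 f (Z h) z) \<and>
    (\<forall>i t x v.
       Omega_boost c i (Q_op c \<gamma> \<sigma>0 f h) (t, x, v) =
         Q_op c \<gamma> \<sigma>0 (Omega_boost c i f) h (t, x, v)
         + Q_op c \<gamma> \<sigma>0 f (Omega_boost c i h) (t, x, v)
         - v $ i / (c * energy c v) * Q_op c \<gamma> \<sigma>0 f h (t, x, v))"
proof -
  obtain C where C: "\<And>\<theta>. \<theta> \<in> {0..pi} \<Longrightarrow> 0 \<le> \<sigma>0 \<theta> \<and> \<sigma>0 \<theta> \<le> C" using assms(5) by blast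
  interpret collision_kernel c \<gamma> \<sigma>0 C using assms(1-4) C by unfold_locales auto
  have dQ: "Q_phase f h differentiable (at z)" for z by (rule Q_phase_differentiable[OF assms(6,7)])
  have df: "f differentiable (at z)" "h differentiable (at z)" for z
    using assms(6,7) smooth_has_derivative by (auto simp: admissible_def differentiable_def)
  have leibniz: "Z (Q_phase f h) z = Q_phase (Z f) h z + Q_phase f (Z h) z"
    if "Z \<in> {d_t} \<union> {d_x i | i. True} \<union> {Omega_rot i j | i j. i \<noteq> j} \<union> {S_field c}" for Z z
  proof -
    obtain t x v where z: "z = (t, x, v)" by (metis surj_pair)
    have "Z = d_t \<or> (\<exists>i. Z = d_x i) \<or> (\<exists>i j. i \<noteq> j \<and> Z = Omega_rot i j) \<or> Z = S_field c"
      using that by (simp only: Un_iff mem_Collect_eq singleton_iff simp_thms) metis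
    then consider "Z = d_t" | i where "Z = d_x i" | i j where "i \<noteq> j" "Z = Omega_rot i j" | "Z = S_field c"
      by metis
    then show ?thesis
    proof cases
      case 1
      show ?thesis
        using Q_phase_boost_identity[OF assms(6,7), of t x v 1 0 0] by (simp add: 1 z d_t_def Q_phase_eq)
    next
      case 2
      show ?thesis
        using Q_phase_boost_identity[OF assms(6,7), of t x v 0 "axis i 1" 0] by (simp add: 2 z d_x_def Q_phase_eq)
    next
      case 3
      show ?thesis
        using Q_phase_rotation_identity[OF 3(1) assms(6,7), of t x v]
        by (simp add: 3 z Omega_rot_eq[OF dQ] Omega_rot_eq[OF df(1)] Omega_rot_eq[OF df(2)] Q_phase_eq)
    next
      case 4
      show ?thesis
        using Q_phase_boost_identity[OF assms(6,7), of t x v "t / c" "(1 / c) *\<^sub>R x" 0]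
        by (simp add: 4 z S_field_eq[OF dQ] S_field_eq[OF df(1)] S_field_eq[OF df(2)] Q_phase_eq)
    qed
  qed
  have boost: "Omega_boost c i (Q_phase f h) (t, x, v) = Q_phase (Omega_boost c i f) h (t, x, v)
      + Q_phase f (Omega_boost c i h) (t, x, v) - v $ i / (c * energy c v) * Q_phase f h (t, x, v)" for i t x v
  proof -
    have "v \<bullet> axis i 1 = v $ i" by (simp add: inner_axis)
    then show ?thesis
      using Q_phase_boost_identity[OF assms(6,7), of t x v "x $ i / c\<^sup>2" "t *\<^sub>R axis i 1" "axis i 1"]
      unfolding Q_phase_eq Omega_boost_eq[OF dQ] Omega_boost_eq[OF df(1)] Omega_boost_eq[OF df(2)] by (simp only:)
  qed
  show ?thesis
  proof (intro conjI ballI allI)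
    show "Q_phase f h differentiable_on UNIV"
      unfolding differentiable_on_def using dQ by simp
  next
    fix Z :: "(phase \<Rightarrow> real) \<Rightarrow> phase \<Rightarrow> real" and z :: phase
    assume "Z \<in> {d_t} \<union> {d_x i | i. True} \<union> {Omega_rot i j | i j. i \<noteq> j} \<union> {S_field c}"
    then show "Z (Q_phase f h) z = Q_phase (Z f) h z + Q_phase f (Z h) z" by (rule leibniz)
  qed (rule boost)
qed

end
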